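(* Let $p,q\ge 1$ be integers, and let $A,B,E_1,\dots,E_p,F_1,\dots,F_q\in\mathbb{C}^{r\times r}$ be matrices such that $E_pF_j=F_jE_p$ for $1\le j\le q$, $F_j+kI$ is invertible for all integers $k\ge0$ and $1\le j\le q$, and $E_p$, $F_q$, $F_q-E_p$ are positive stable. Let $x>0$ be real and let $v\in\mathbb{C}$ be such that the series defining ${}_pE_q\left[(x,A,B;v)\,\big|\begin{smallmatrix}E_1,\dots,E_p \\ F_1,\dots,F_q\end{smallmatrix}\right]$ and ${}_{p-1}E_{q-1}\left[(x,A,B;v)\,\big|\begin{smallmatrix}E_1,\dots,E_{p-1} \\ F_1,\dots,F_{q-1}\end{smallmatrix}\right]$ converge absolutely. Then $${}_pE_q\left[(x,A,B;v)\,\Big|\begin{array}{c}E_1,\dots,E_p \\ F_1,\dots,F_q\end{array}\right]=\left(\int_0^1 {}_{p-1}E_{q-1}\left[(x,A,B;tv)\,\Big|\begin{array}{c}E_1,\dots,E_{p-1} \\ F_1,\dots,F_{q-1}\end{array}\right]t^{E_p-I}(1-t)^{F_q-E_p-I}\,dt\right)\big[\mathfrak{B}(E_p,F_q-E_p)\big]^{-1}.$$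
   Context: $\mathbb{C}^{r\times r}$ is the space of complex $r\times r$ matrices and $I$ is the identity matrix. A matrix $M$ is positive stable if every eigenvalue of $M$ has positive real part. For real $s>0$, $s^{M}=\exp(M\ln s)$. For positive stable $M$, $\Gamma(M)=\int_0^\infty e^{-s}s^{M-I}ds$. $\Gamma^{-1}(M)$ denotes the entire function $1/\Gamma(z)$ applied to $M$ by the matrix functional calculus (the matrix inverse of $\Gamma(M)$ when $M$ is positive stable). For $x>0$, $\Gamma(M,x)=\int_x^\infty e^{-s}s^{M-I}ds$ (convergent for every $M$ since $x>0$). The Pochhammer symbol is $(M)_0=I$, $(M)_m=M(M+I)\cdots(M+(m-1)I)$ for $m\ge1$, and $(M)_m^{-1}$ is its matrix inverse. For commuting positive stable matrices $E,F$, the beta matrix function is $\mathfrak{B}(E,F)=\Gamma(E)\Gamma(F)\Gamma^{-1}(E+F)=\int_0^1 t^{E-I}(1-t)^{F-I}dt$. The generalized incomplete exponential matrix function is, with matrix products in the order written, $${}_pE_q\left[(x,A,B;v)\,\Big|\begin{array}{c}E_1,\dots,E_p \\ F_1,\dots,F_q\end{array}\right]=\sum_{m=0}^\infty \Gamma^{-1}(mA+B)\,\Gamma(mA+B,x)\,(E_1)_m\cdots(E_p)_m\,(F_1)_m^{-1}\cdots(F_q)_m^{-1}\frac{v^m}{m!}$$ (when $p=0$ or $q=0$ the corresponding product is $I$). Absolute convergence means convergence of the sum of norms of the terms. *)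

theory Defs
  imports "HOL-Analysis.Analysis"
begin

text \<open>
  Matrices in \<open>\<complex>\<^sup>r\<^sup>\<times>\<^sup>r\<close> are elements of \<^typ>\<open>complex^'r^'r\<close>, with product \<open>**\<close> and
  identity \<^term>\<open>mat 1\<close>; the scalar matrix \<open>cI\<close> is \<^term>\<open>mat c\<close>. The operations \<open>*\<close>, \<open>^\<close> and
  \<open>1\<close> on this type are componentwise and are not used on matrices.
\<close>

definition positive_stable :: "complex^'r^'r \<Rightarrow> bool" where
  "positive_stable M \<longleftrightarrow> (\<forall>l v. v \<noteq> 0 \<and> M *v v = l *s v \<longrightarrow> Re l > 0)"

primrec mat_power :: "complex^'r^'r \<Rightarrow> nat \<Rightarrow> complex^'r^'r" where
  "mat_power M 0 = mat 1"
| "mat_power M (Suc n) = mat_power M n ** M"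

definition mat_exp :: "complex^'r^'r \<Rightarrow> complex^'r^'r" where
  "mat_exp M = (\<Sum>n. (1 / fact n) *\<^sub>R mat_power M n)"

text \<open>\<open>s\<^sup>M\<close> for real \<open>s > 0\<close>:\<close>

definition mat_powr :: "real \<Rightarrow> complex^'r^'r \<Rightarrow> complex^'r^'r" where
  "mat_powr s M = mat_exp (ln s *\<^sub>R M)"

text \<open>
  Matrix functional calculus \<open>f(M)\<close> for an entire function \<open>f\<close>: its Taylor series at \<open>0\<close>, which
  converges everywhere, evaluated at \<open>M\<close>.
\<close>

definition mat_entire :: "(complex \<Rightarrow> complex) \<Rightarrow> complex^'r^'r \<Rightarrow> complex^'r^'r" where
  "mat_entire f M = (\<Sum>n. mat ((deriv ^^ n) f 0 / fact n) ** mat_power M n)"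

text \<open>
  \<open>\<Gamma>\<inverse>(M)\<close> is the entire function \<^term>\<open>rGamma\<close> \<open>= 1/\<Gamma>\<close> applied to \<open>M\<close>; it makes sense for every
  \<open>M\<close>, also when \<open>\<Gamma>(M)\<close> does not exist.
\<close>

definition mat_rGamma :: "complex^'r^'r \<Rightarrow> complex^'r^'r" where
  "mat_rGamma M = mat_entire rGamma M"

definition mat_Gamma :: "complex^'r^'r \<Rightarrow> complex^'r^'r" where
  "mat_Gamma M = (LINT s:{0<..}|lborel. exp (- s) *\<^sub>R mat_powr s (M - mat 1))"

definition mat_inc_Gamma :: "complex^'r^'r \<Rightarrow> real \<Rightarrow> complex^'r^'r" where
  "mat_inc_Gamma M x = (LINT s:{x<..}|lborel. exp (- s) *\<^sub>R mat_powr s (M - mat 1))"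

definition mat_Beta :: "complex^'r^'r \<Rightarrow> complex^'r^'r \<Rightarrow> complex^'r^'r" where
  "mat_Beta E F = mat_Gamma E ** mat_Gamma F ** mat_rGamma (E + F)"

primrec mat_pochhammer :: "complex^'r^'r \<Rightarrow> nat \<Rightarrow> complex^'r^'r" where
  "mat_pochhammer M 0 = mat 1"
| "mat_pochhammer M (Suc m) = mat_pochhammer M m ** (M + mat (of_nat m))"

text \<open>The ordered product \<open>X\<^sub>1 X\<^sub>2 \<dots> X\<^sub>n\<close>, with factors indexed from \<open>1\<close>:\<close>

primrec mat_prod :: "(nat \<Rightarrow> complex^'r^'r) \<Rightarrow> nat \<Rightarrow> complex^'r^'r" where
  "mat_prod X 0 = mat 1"
| "mat_prod X (Suc n) = mat_prod X n ** X (Suc n)"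

text \<open>
  The generalized incomplete exponential matrix function \<open>\<^sub>pE\<^sub>q\<close>. Of the families \<open>E\<close> and \<open>F\<close> only
  \<open>E 1, \<dots>, E p\<close> and \<open>F 1, \<dots>, F q\<close> are used.
\<close>

definition inc_exp_term ::
  "nat \<Rightarrow> nat \<Rightarrow> real \<Rightarrow> complex^'r^'r \<Rightarrow> complex^'r^'r \<Rightarrow> (nat \<Rightarrow> complex^'r^'r) \<Rightarrow>
   (nat \<Rightarrow> complex^'r^'r) \<Rightarrow> complex \<Rightarrow> nat \<Rightarrow> complex^'r^'r" where
  "inc_exp_term p q x A B E F v m =
     mat (v ^ m / fact m) **
     (mat_rGamma (real m *\<^sub>R A + B) ** mat_inc_Gamma (real m *\<^sub>R A + B) x **
      mat_prod (\<lambda>i. mat_pochhammer (E i) m) p **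
      mat_prod (\<lambda>j. matrix_inv (mat_pochhammer (F j) m)) q)"

definition inc_exp_mat ::
  "nat \<Rightarrow> nat \<Rightarrow> real \<Rightarrow> complex^'r^'r \<Rightarrow> complex^'r^'r \<Rightarrow> (nat \<Rightarrow> complex^'r^'r) \<Rightarrow>
   (nat \<Rightarrow> complex^'r^'r) \<Rightarrow> complex \<Rightarrow> complex^'r^'r" where
  "inc_exp_mat p q x A B E F v = (\<Sum>m. inc_exp_term p q x A B E F v m)"

end

theory Submission
  imports Defs
    "HOL-Computational_Algebra.Fundamental_Theorem_Algebra"
    "HOL-Complex_Analysis.Cauchy_Integral_Formula"
    "HOL-Real_Asymp.Real_Asymp"
begin

text \<open>
  Put \<open>E = E\<^sub>p\<close>, \<open>F = F\<^sub>q\<close>, \<open>G = F - E\<close>. Since \<open>E\<close> commutes with all \<open>F\<^sub>j\<close>, each term of \<open>\<^sub>pE\<^sub>q\<close> is the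
  corresponding term of \<open>\<^sub>p\<^sub>-\<^sub>1E\<^sub>q\<^sub>-\<^sub>1\<close> times \<open>(E)\<^sub>m(F)\<^sub>m\<inverse>\<close>, and the latter times \<open>B(E, G)\<close> is the moment
  \<open>\<integral> t\<^sup>m t\<^sup>E\<^sup>-\<^sup>I (1 - t)\<^sup>G\<^sup>-\<^sup>I dt\<close>; absolute convergence then lets one sum under the integral.

  The moments come from \<open>\<Gamma>(E)\<Gamma>(G) = \<Gamma>(E + G) \<integral> t\<^sup>E\<^sup>-\<^sup>I (1 - t)\<^sup>G\<^sup>-\<^sup>I dt\<close>, which is Fubini's theorem as in the
  scalar case, together with \<open>\<Gamma>(M + mI) = (M)\<^sub>m \<Gamma>(M)\<close> and \<open>\<Gamma>\<inverse>(M) \<Gamma>(M) = I\<close>. All integrals converge because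
  the eigenvalues of a positive stable \<open>M\<close> being in the right half plane forces \<open>e\<^sup>-\<^sup>u\<^sup>M\<close> to decay
  exponentially.
\<close>

subsection \<open>Matrix multiplication and the matrix exponential\<close>

text \<open>The componentwise product of the type is of no use here, so exponentials, power series
  and Cauchy products are built on \<open>**\<close>, known only as a bounded bilinear map; hence
  the unspecified constant and the factor \<open>norm (mat 1)\<close> in the estimates. Stability
  speaks of eigenvalues, convergence needs norms. The bridge is an annihilating polynomial all of
  whose roots are eigenvalues; no normal form of M is involved. \<Gamma>\<inverse>(M) is a Taylor
  series at 0, whereas \<Gamma> has a pole at 0 and so no Taylor series there to multiply it with.
  Shifting by an integer n beyond the growth rate L of the powers of M removes this obstacle: the
  expansion of \<Gamma>(n + z) about z = 0 converges at M, and its coefficients are the same for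
  complex numbers and for matrices. The shift is undone by cancelling (M)_n. The matrices E_i need
  not commute with one another, nor the F_j, so the only factor moved inside a term is (E_p)_m, and
  the beta factor stays at the far right until it is inverted.\<close>

lemma bounded_bilinear_matrix_mult:
  "bounded_bilinear ((**) :: complex^'n^'m \<Rightarrow> complex^'p^'n \<Rightarrow> complex^'p^'m)"
proof -
  have "bilinear ((**) :: complex^'n^'m \<Rightarrow> complex^'p^'n \<Rightarrow> complex^'p^'m)"
    unfolding bilinear_def linear_iff
    by (simp add: matrix_matrix_mult_def vec_eq_iff algebra_simps sum.distrib scaleR_sum_right)
  thus ?thesis by (simp add: bilinear_conv_bounded_bilinear)
qed

interpretation matmul: bounded_bilinear "(**) :: complex^'n^'m \<Rightarrow> complex^'p^'n \<Rightarrow> complex^'p^'m"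
  by (rule bounded_bilinear_matrix_mult)

lemma mat_mult_entry: "(mat c ** X) $ i $ j = (c::complex) * X $ i $ j"
  by (simp add: matrix_matrix_mult_def mat_def if_distrib if_distribR cong: if_cong)

lemma mult_mat_entry: "(X ** mat c) $ i $ j = X $ i $ j * (c::complex)"
  by (simp add: matrix_matrix_mult_def mat_def if_distrib if_distribR cong: if_cong)

lemma mat_commute: "X ** mat c = mat (c::complex) ** X"
  by (simp add: vec_eq_iff mat_mult_entry mult_mat_entry mult.commute)

lemma mat_mult_mat: "mat a ** mat b = mat (a * b :: complex)"
  by (simp add: vec_eq_iff mat_mult_entry) (simp add: mat_def)

lemma mat_add: "mat (a + b :: complex) = mat a + mat b"
  by (simp add: vec_eq_iff mat_def)

lemma scaleR_conv_mat: "r *\<^sub>R X = mat (of_real r) ** (X :: complex^'n^'m)"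
  by (simp add: vec_eq_iff mat_mult_entry) (simp add: scaleR_conv_of_real[where 'a=complex])

lemma mat_uminus: "mat (- c :: complex) = - mat c"
  by (simp add: vec_eq_iff mat_def)

lemma scaleR_mat: "r *\<^sub>R mat c = mat (of_real r * c :: complex)"
  by (simp add: scaleR_conv_mat mat_mult_mat)

lemma norm_mat_mult: "norm (mat c ** X) = cmod c * norm (X :: complex^'n^'m)"
  by (simp add: norm_vec_def mat_mult_entry norm_mult L2_set_right_distrib)

lemma mat_power_commute:
  assumes "X ** M = M ** X"
  shows "X ** mat_power M n = mat_power M n ** X"
  by (induction n) (simp_all add: matrix_mul_assoc, metis assms matrix_mul_assoc)

lemma mat_power_Suc': "mat_power M (Suc n) = M ** mat_power M n"
  using mat_power_commute[of M M n] by simp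

lemma mat_power_add: "mat_power M (m + n) = mat_power M m ** mat_power M n"
  by (induction n) (simp_all add: matrix_mul_assoc)

lemma mat_power_scaleR: "mat_power (r *\<^sub>R M) n = (r ^ n) *\<^sub>R mat_power M n"
  by (induction n) (simp_all add: matmul.scaleR_left matmul.scaleR_right)

text \<open>The rate is L = K * norm M + 1, where K is the constant of the bilinear map
  \<open>**\<close>; the added 1 keeps L positive even for M = 0, as later divisions by powers of L
  and radii of convergence require.\<close>

lemma mat_power_bound:
  fixes M :: "complex^'r^'r"
  obtains L where "L > 0" "\<And>n. norm (mat_power M n) \<le> norm (mat 1 :: complex^'r^'r) * L ^ n"
proof -
  obtain K where K: "K > 0" "\<And>(A :: complex^'r^'r) (B :: complex^'r^'r). norm (A ** B) \<le> norm A * norm B * K"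
    using matmul.pos_bounded by blast
  have "norm (mat_power M n) \<le> norm (mat 1 :: complex^'r^'r) * (K * norm M + 1) ^ n" for n
  proof (induction n)
    case (Suc n)
    have "norm (mat_power M (Suc n)) \<le> norm (mat_power M n) * norm M * K"
      using K(2) by simp
    also have "\<dots> = norm (mat_power M n) * (K * norm M)" by simp
    also have "\<dots> \<le> norm (mat 1 :: complex^'r^'r) * (K * norm M + 1) ^ n * (K * norm M + 1)"
      by (rule mult_mono) (use Suc K in \<open>auto intro!: mult_nonneg_nonneg zero_le_power add_nonneg_nonneg\<close>)
    finally show ?case by (simp add: mult_ac)
  qed simp
  moreover have "K * norm M + 1 > 0" using K by (simp add: add_nonneg_pos)
  ultimately show ?thesis using that by blast
qed

lemma summable_norm_mat_exp:
  "summable (\<lambda>n. norm ((1 / fact n) *\<^sub>R mat_power (M :: complex^'r^'r) n))"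
proof -
  obtain L where L: "L > 0" "\<And>n. norm (mat_power M n) \<le> norm (mat 1 :: complex^'r^'r) * L ^ n"
    using mat_power_bound[of M] by blast
  have "summable (\<lambda>n. norm (mat 1 :: complex^'r^'r) * (L ^ n /\<^sub>R fact n))"
    by (intro summable_mult summable_exp_generic)
  thus ?thesis
    by (rule summable_comparison_test') (use L in \<open>auto simp: divide_simps\<close>)
qed

lemma mat_exp_sums: "(\<lambda>n. (1 / fact n) *\<^sub>R mat_power M n) sums mat_exp M"
  unfolding mat_exp_def by (rule summable_sums[OF summable_norm_cancel[OF summable_norm_mat_exp]])

lemma mat_exp_commute:
  assumes "X ** M = M ** X"
  shows "X ** mat_exp M = mat_exp M ** X"
proof -
  have "(\<lambda>n. X ** ((1 / fact n) *\<^sub>R mat_power M n)) sums (X ** mat_exp M)"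
    by (intro matmul.bounded_linear_right[THEN bounded_linear.sums] mat_exp_sums)
  moreover have "(\<lambda>n. ((1 / fact n) *\<^sub>R mat_power M n) ** X) sums (mat_exp M ** X)"
    by (intro matmul.bounded_linear_left[THEN bounded_linear.sums] mat_exp_sums)
  ultimately show ?thesis
    by (simp add: matmul.scaleR_left matmul.scaleR_right mat_power_commute[OF assms] sums_unique2)
qed

lemma mat_exp_0 [simp]: "mat_exp 0 = (mat 1 :: complex^'r^'r)"
proof -
  have "(1 / fact n) *\<^sub>R mat_power 0 n = (if n = 0 then mat 1 else 0 :: complex^'r^'r)" for n
    by (cases n) (simp_all add: matmul.zero_right)
  hence "(\<lambda>n. if n = 0 then mat 1 else 0) sums mat_exp (0 :: complex^'r^'r)"
    using mat_exp_sums[of "0 :: complex^'r^'r"] by simp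
  thus ?thesis
    using sums_single[of 0 "\<lambda>_. mat 1 :: complex^'r^'r"] sums_unique2 by blast
qed

section \<open>Derivative and functional equation of the matrix exponential\<close>

lemma has_vector_derivative_vec:
  fixes f :: "real \<Rightarrow> 'a::real_normed_vector^'n"
  assumes "\<And>i. ((\<lambda>x. f x $ i) has_vector_derivative D $ i) F"
  shows "(f has_vector_derivative D) F"
proof -
  \<comment> \<open>\<open>Lim F (\<lambda>x. x)\<close> is the base point in the definition of a
    derivative along an arbitrary filter; the difference quotient tends to 0 because each of its
    components does.\<close>
  have "((\<lambda>y. ((f y - f (Lim F (\<lambda>x. x))) - (y - Lim F (\<lambda>x. x)) *\<^sub>R D) /\<^sub>R
      norm (y - Lim F (\<lambda>x. x))) \<longlongrightarrow> 0) F"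
    using assms unfolding has_vector_derivative_def has_derivative_def
    by (intro vec_tendstoI) simp
  thus ?thesis
    unfolding has_vector_derivative_def has_derivative_def by (simp add: bounded_linear_scaleR_left)
qed

lemma sums_matrix_entry:
  fixes f :: "nat \<Rightarrow> 'a::real_normed_vector^'n^'m"
  shows "f sums s \<Longrightarrow> (\<lambda>n. f n $ i $ j) sums (s $ i $ j)"
  by (intro bounded_linear.sums[OF bounded_linear_vec_nth])

text \<open>Each entry is an everywhere convergent scalar power series in u, so it may be
  differentiated termwise; passing from \<open>c\<close> to \<open>diffs c\<close> is left
  multiplication of the series by A. The differentiation is complex and is then restricted to real
  u.\<close>

lemma mat_exp_has_vector_derivative:
  "((\<lambda>u. mat_exp (u *\<^sub>R A)) has_vector_derivative A ** mat_exp (u *\<^sub>R A)) (at u within S)"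
proof (rule has_vector_derivative_vec, rule has_vector_derivative_vec)
  fix i j
  define c where "c n = (mat_power A n $ i $ j) / fact n" for n
  have sm: "(\<lambda>n. c n * of_real u ^ n) sums (mat_exp (u *\<^sub>R A) $ i $ j)" for u
  proof -
    have "(\<lambda>n. ((1 / fact n) *\<^sub>R mat_power (u *\<^sub>R A) n) $ i $ j) sums (mat_exp (u *\<^sub>R A) $ i $ j)"
      by (intro sums_matrix_entry mat_exp_sums)
    thus ?thesis unfolding c_def mat_power_scaleR
      by (simp add: mult_ac scaleR_conv_of_real[where 'a=complex])
  qed
  have sm': "(\<lambda>n. diffs c n * of_real u ^ n) sums ((A ** mat_exp (u *\<^sub>R A)) $ i $ j)"
  proof -
    have "(\<lambda>n. (A ** ((1 / fact n) *\<^sub>R mat_power (u *\<^sub>R A) n)) $ i $ j) sums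
            ((A ** mat_exp (u *\<^sub>R A)) $ i $ j)"
      by (intro sums_matrix_entry bounded_linear.sums[OF matmul.bounded_linear_right] mat_exp_sums)
    moreover have "1 + complex_of_nat n \<noteq> 0" for n
      using of_nat_neq_0[of n, where 'a=complex] by simp
    hence "(A ** ((1 / fact n) *\<^sub>R mat_power (u *\<^sub>R A) n)) $ i $ j
       = diffs c n * of_real u ^ n" for n
      by (simp add: c_def diffs_def mat_power_scaleR matmul.scaleR_right flip: mat_power_Suc')
         (simp add: mat_power_Suc' scaleR_conv_of_real[where 'a=complex] field_simps del: of_nat_Suc)
    ultimately show ?thesis by simp
  qed
  have "summable (\<lambda>n. c n * y ^ n)" for y
    using powser_inside[of c "of_real (norm y + 1)" y] sm[of "norm y + 1"]
    by (simp add: sums_iff del: of_real_add)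
  from termdiffs_strong_converges_everywhere[OF this, of "of_real u"]
  have "((\<lambda>x. \<Sum>n. c n * x ^ n) has_field_derivative (A ** mat_exp (u *\<^sub>R A)) $ i $ j)
          (at (of_real u))"
    using sm' by (simp add: sums_iff)
  moreover have "((of_real :: real \<Rightarrow> complex) has_vector_derivative 1) (at u within S)"
    using has_vector_derivative_of_real[OF DERIV_ident] by simp
  ultimately have "((\<lambda>x. \<Sum>n. c n * of_real x ^ n) has_vector_derivative
      (A ** mat_exp (u *\<^sub>R A)) $ i $ j) (at u within S)"
    using field_vector_diff_chain_within[of of_real 1 u S "\<lambda>x. \<Sum>n. c n * x ^ n"]
    by (auto simp: o_def intro: DERIV_subset)
  thus "((\<lambda>x. mat_exp (x *\<^sub>R A) $ i $ j) has_vector_derivative (A ** mat_exp (u *\<^sub>R A)) $ i $ j)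
          (at u within S)"
    using sm by (simp add: sums_iff)
qed

text \<open>The product \<open>e\<^sup>u\<^sup>(\<^sup>A\<^sup>+\<^sup>B\<^sup>)e\<^sup>-\<^sup>u\<^sup>Ae\<^sup>-\<^sup>u\<^sup>B\<close> has derivative \<open>0\<close>, hence is constantly \<open>I\<close>.\<close>

lemma mat_exp_add_minus:
  fixes A B :: "complex^'r^'r"
  assumes AB: "A ** B = B ** A"
  shows "mat_exp (A + B) ** mat_exp (- A) ** mat_exp (- B) = mat 1"
proof -
  define X Y Z where "X u = mat_exp (u *\<^sub>R (A + B))" and "Y u = mat_exp (u *\<^sub>R (- A))"
    and "Z u = mat_exp (u *\<^sub>R (- B))" for u :: real
  have comm: "A ** X u = X u ** A" "B ** X u = X u ** B" "B ** Y u = Y u ** B" for u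
    unfolding X_def Y_def
    by (intro mat_exp_commute; simp add: AB matmul.scaleR_left matmul.scaleR_right
        matmul.add_left matmul.add_right matmul.minus_left matmul.minus_right)+
  have "((\<lambda>u. X u ** Y u ** Z u) has_vector_derivative 0) (at u within S)" for u S
  proof -
    have "((\<lambda>u. X u ** Y u ** Z u) has_vector_derivative
        (X u ** Y u) ** ((- B) ** Z u) + (X u ** ((- A) ** Y u) + ((A + B) ** X u) ** Y u) ** Z u)
        (at u within S)"
      unfolding X_def Y_def Z_def
      by (intro matmul.has_vector_derivative mat_exp_has_vector_derivative)
    moreover have "(X u ** Y u) ** ((- B) ** Z u) = - (X u ** B ** Y u ** Z u)"
      by (simp add: matmul.minus_left matmul.minus_right comm flip: matrix_mul_assoc)
    moreover have "((A + B) ** X u) ** Y u = X u ** A ** Y u + X u ** B ** Y u"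
      by (simp add: comm matmul.add_left)
    ultimately show ?thesis
      by (simp add: matrix_mul_assoc matmul.add_left matmul.minus_left matmul.minus_right)
  qed
  then obtain C where C: "\<And>u. u \<in> UNIV \<Longrightarrow> X u ** Y u ** Z u = C"
    using has_vector_derivative_zero_constant[of UNIV "\<lambda>u. X u ** Y u ** Z u"] by auto
  have "X 1 ** Y 1 ** Z 1 = X 0 ** Y 0 ** Z 0" by (simp add: C)
  thus ?thesis by (simp add: X_def Y_def Z_def)
qed

lemma mat_exp_minus: "mat_exp A ** mat_exp (- A) = mat 1"
  using mat_exp_add_minus[of A 0] by (simp add: matmul.zero_left matmul.zero_right)

lemma mat_exp_add:
  fixes A B :: "complex^'r^'r"
  assumes "A ** B = B ** A"
  shows "mat_exp (A + B) = mat_exp A ** mat_exp B"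
proof -
  have "mat_exp (A + B) ** mat_exp (- A) ** (mat_exp (- B) ** mat_exp B) ** mat_exp A
      = mat_exp B ** mat_exp A"
    using mat_exp_add_minus[OF assms] by (simp add: matrix_mul_assoc)
  moreover have "mat_exp (- B) ** mat_exp B = mat 1" "mat_exp (- A) ** mat_exp A = mat 1"
    using mat_exp_minus[of "- A"] mat_exp_minus[of "- B"] by simp_all
  ultimately have "mat_exp (A + B) = mat_exp B ** mat_exp A"
    by (metis matrix_mul_assoc matrix_mul_rid)
  also have "\<dots> = mat_exp A ** mat_exp B"
    using assms by (metis mat_exp_commute)
  finally show ?thesis .
qed

lemma mat_exp_mat: "mat_exp (mat c) = (mat (exp c) :: complex^'r^'r)"
proof -
  have "mat_power (mat c) n = (mat (c ^ n) :: complex^'r^'r)" for n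
    by (induction n) (simp_all add: mat_mult_mat mult.commute)
  hence "(1 / fact n) *\<^sub>R mat_power (mat c) n = (mat (c ^ n /\<^sub>R fact n) :: complex^'r^'r)" for n
    by (simp only: scaleR_mat) (simp add: scaleR_conv_of_real[where 'a=complex] divide_inverse)
  moreover have "bounded_linear (mat :: complex \<Rightarrow> complex^'r^'r)"
    unfolding linear_conv_bounded_linear[symmetric]
    by (simp add: linear_iff mat_add scaleR_mat) (simp add: scaleR_conv_of_real[where 'a=complex])
  from bounded_linear.sums[OF this exp_converges]
  have "(\<lambda>n. mat (c ^ n /\<^sub>R fact n)) sums (mat (exp c) :: complex^'r^'r)" .
  ultimately have "(\<lambda>n. (1 / fact n) *\<^sub>R mat_power (mat c) n) sums (mat (exp c) :: complex^'r^'r)"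
    by simp
  from sums_unique2[OF mat_exp_sums this] show ?thesis .
qed

lemma mat_exp_add_mat: "mat_exp (A + mat c) = mat (exp c) ** mat_exp A"
  by (simp add: mat_exp_add mat_commute mat_exp_mat)

text \<open>A crude bound for both signs of u and for every M. It controls s^M for s > 1, where
  stability gives no upper bound.\<close>

lemma norm_mat_exp_le:
  fixes M :: "complex^'r^'r"
  obtains L where "L > 0"
    "\<And>u. norm (mat_exp (u *\<^sub>R M)) \<le> norm (mat 1 :: complex^'r^'r) * exp (L * \<bar>u\<bar>)"
proof -
  obtain L where L: "L > 0" "\<And>n. norm (mat_power M n) \<le> norm (mat 1 :: complex^'r^'r) * L ^ n"
    using mat_power_bound[of M] by blast
  have "norm (mat_exp (u *\<^sub>R M)) \<le> norm (mat 1 :: complex^'r^'r) * exp (L * \<bar>u\<bar>)" for u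
  proof -
    have s: "(\<lambda>n. norm (mat 1 :: complex^'r^'r) * ((L * \<bar>u\<bar>) ^ n /\<^sub>R fact n)) sums
       (norm (mat 1 :: complex^'r^'r) * exp (L * \<bar>u\<bar>))"
      by (intro sums_mult exp_converges)
    have "norm (mat_exp (u *\<^sub>R M)) \<le> (\<Sum>n. norm ((1 / fact n) *\<^sub>R mat_power (u *\<^sub>R M) n))"
      unfolding mat_exp_def by (intro summable_norm summable_norm_mat_exp)
    also have "\<dots> \<le> (\<Sum>n. norm (mat 1 :: complex^'r^'r) * ((L * \<bar>u\<bar>) ^ n /\<^sub>R fact n))"
    proof (intro suminf_le summable_norm_mat_exp)
      fix n
      have "\<bar>u\<bar> ^ n / fact n * norm (mat_power M n) \<le>
          \<bar>u\<bar> ^ n / fact n * (norm (mat 1 :: complex^'r^'r) * L ^ n)"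
        by (intro mult_left_mono L) simp
      thus "norm ((1 / fact n) *\<^sub>R mat_power (u *\<^sub>R M) n)
             \<le> norm (mat 1 :: complex^'r^'r) * ((L * \<bar>u\<bar>) ^ n /\<^sub>R fact n)"
        by (simp add: mat_power_scaleR abs_mult power_abs power_mult_distrib divide_inverse mult_ac)
    qed (use s in \<open>simp add: sums_iff\<close>)
    also have "\<dots> = norm (mat 1 :: complex^'r^'r) * exp (L * \<bar>u\<bar>)"
      using s by (simp add: sums_iff)
    finally show ?thesis .
  qed
  from that[OF L(1) this] show ?thesis .
qed

subsection \<open>Exponential decay for positive stable matrices\<close>

definition poly_mat :: "complex poly \<Rightarrow> complex^'r^'r \<Rightarrow> complex^'r^'r" where
  "poly_mat p M = (\<Sum>i\<le>degree p. mat (coeff p i) ** mat_power M i)"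

lemma mat_0 [simp]: "mat 0 = (0 :: complex^'r^'r)"
  by (simp add: vec_eq_iff mat_def)

text \<open>A common upper summation bound lets polynomials of different degrees be added, also when
  leading terms cancel.\<close>

lemma poly_mat_altdef:
  assumes "degree p \<le> n"
  shows "poly_mat p M = (\<Sum>i\<le>n. mat (coeff p i) ** mat_power M i)"
  unfolding poly_mat_def
  by (rule sum.mono_neutral_left) (use assms in \<open>auto simp: coeff_eq_0 matmul.zero_left\<close>)

lemma poly_mat_const: "poly_mat [:c:] M = mat c"
  by (simp add: poly_mat_def)

lemma poly_mat_add: "poly_mat (p + q) M = poly_mat p M + poly_mat q M"
proof -
  define n where "n = max (degree p) (degree q)"
  have "degree (p + q) \<le> n" "degree p \<le> n" "degree q \<le> n"
    by (auto simp: n_def intro: degree_add_le)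
  thus ?thesis
    by (simp add: poly_mat_altdef[of _ n] mat_add matmul.add_left sum.distrib)
qed

lemma poly_mat_smult: "poly_mat (smult c p) M = mat c ** poly_mat p M"
proof -
  have "degree (smult c p) \<le> degree p" by (rule degree_smult_le)
  thus ?thesis
    by (simp add: poly_mat_altdef[of _ "degree p"] matmul.sum_right matrix_mul_assoc mat_mult_mat)
qed

lemma poly_mat_pCons: "poly_mat (pCons a p) M = mat a + poly_mat p M ** M"
proof -
  have "degree (pCons a p) \<le> Suc (degree p)" by (rule degree_pCons_le)
  hence "poly_mat (pCons a p) M = (\<Sum>i\<le>Suc (degree p). mat (coeff (pCons a p) i) ** mat_power M i)"
    by (rule poly_mat_altdef)
  also have "\<dots> = mat a + (\<Sum>i\<le>degree p. mat (coeff p i) ** mat_power M i ** M)"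
    by (simp add: sum.atMost_Suc_shift matrix_mul_assoc del: sum.atMost_Suc)
  finally show ?thesis by (simp add: poly_mat_def matmul.sum_left)
qed

lemma poly_mat_mult_linear: "poly_mat (p * [:c, 1:]) M = poly_mat p M ** (M + mat c)"
  by (simp add: poly_mat_add poly_mat_smult poly_mat_pCons matmul.add_right mat_commute add.commute)

lemma poly_mat_sum_monom:
  "poly_mat (\<Sum>i\<in>S. monom (c i) (f i)) M = (\<Sum>i\<in>S. mat (c i) ** mat_power M (f i))"
  if "finite S"
  using that
proof induction
  case empty
  show ?case using poly_mat_const[of 0 M] by simp
next
  case (insert x S)
  have "poly_mat (monom (c x) (f x)) M = mat (c x) ** mat_power M (f x)"
    by (simp add: poly_mat_altdef[OF degree_monom_le] if_distribR if_distrib matmul.zero_left cong: if_cong)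
  thus ?case using insert by (simp add: poly_mat_add)
qed

text \<open>The space of matrices has finite real dimension N, so the N + 1 powers up to M^N are
  linearly dependent. Dependence is a property of sets, in which equal powers would collapse; a
  repetition M^i = M^j is therefore treated first, by the polynomial x^i - x^j.\<close>

lemma exists_annihilating_poly:
  fixes M :: "complex^'r^'r"
  shows "\<exists>p. p \<noteq> 0 \<and> poly_mat p M = 0"
proof (cases "inj (mat_power M)")
  case False
  then obtain i j where ij: "i \<noteq> j" "mat_power M i = mat_power M j" by (auto simp: inj_on_def)
  define p where "p = (\<Sum>k\<in>{i, j}. monom (if k = i then 1 else - 1 :: complex) k)"
  have "mat (- 1) ** mat_power M i + mat_power M i = mat (- 1 + 1) ** mat_power M i"
    by (simp only: mat_add matmul.add_left matrix_mul_lid)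
  hence "poly_mat p M = 0"
    unfolding p_def using ij by (subst poly_mat_sum_monom) (simp_all add: add.commute matmul.zero_left)
  moreover have "coeff p i = 1" using ij by (simp add: p_def coeff_sum)
  ultimately show ?thesis by (metis coeff_0 zero_neq_one)
next
  case True
  define N where "N = DIM(complex^'r^'r)"
  define S where "S = mat_power M ` {..N}"
  have cS: "finite S" "card S = Suc N"
    using True by (auto simp: S_def card_image inj_on_subset)
  hence "dependent S" using independent_bound[of S] by (auto simp: N_def)
  then obtain u where u: "\<exists>v\<in>S. u v \<noteq> 0" "(\<Sum>v\<in>S. u v *\<^sub>R v) = 0"
    using cS(1) by (auto simp: real_vector.dependent_finite)
  define p where "p = (\<Sum>k\<le>N. monom (complex_of_real (u (mat_power M k))) k)"
  have "poly_mat p M = (\<Sum>k\<le>N. u (mat_power M k) *\<^sub>R mat_power M k)"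
    unfolding p_def by (subst poly_mat_sum_monom) (simp_all add: scaleR_conv_mat)
  also have "\<dots> = (\<Sum>v\<in>S. u v *\<^sub>R v)"
    unfolding S_def using True by (subst sum.reindex) (auto intro: inj_on_subset)
  finally have "poly_mat p M = 0" using u(2) by simp
  moreover from u(1) obtain k where k: "k \<le> N" "u (mat_power M k) \<noteq> 0" by (auto simp: S_def)
  have "coeff p k = u (mat_power M k)"
    using k by (simp add: p_def coeff_sum)
  with k have "p \<noteq> 0" by auto
  ultimately show ?thesis by blast
qed

text \<open>A root of an annihilating polynomial of minimal degree is an eigenvalue: otherwise the
  corresponding linear factor could be cancelled.\<close>

lemma annihilating_poly_eigenvalues:
  fixes M :: "complex^'r^'r"
  obtains p where "p \<noteq> 0" "poly_mat p M = 0"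
    "\<And>z. poly p z = 0 \<Longrightarrow> \<exists>v. v \<noteq> 0 \<and> M *v v = z *s v"
proof -
  define P where "P p \<longleftrightarrow> p \<noteq> 0 \<and> poly_mat p M = 0" for p
  obtain p where p: "P p" "\<And>q. P q \<Longrightarrow> degree p \<le> degree q"
    using exists_annihilating_poly[of M] ex_has_least_nat[of P _ degree] by (metis P_def)
  have "\<exists>v. v \<noteq> 0 \<and> M *v v = z *s v" if "poly p z = 0" for z
  proof -
    from that obtain q where q: "p = q * [:- z, 1:]"
      by (metis poly_eq_0_iff_dvd dvdE mult.commute)
    have "q \<noteq> 0" using p q by (auto simp: P_def)
    hence "degree q < degree p" by (simp add: q degree_mult_eq del: mult_pCons_right)
    with p(2)[of q] \<open>q \<noteq> 0\<close> have "poly_mat q M \<noteq> 0" by (auto simp: P_def)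
    have "M ** mat_power M n = mat_power M n ** M" for n by (rule mat_power_commute) simp
    hence "(M + mat c) ** mat_power M n = mat_power M n ** (M + mat c)" for n c
      by (simp add: matmul.add_left matmul.add_right mat_commute)
    \<comment> \<open>The linear factor is moved to the left so that q(M) acts first: any nonzero
      q(M)w is then an eigenvector for z.\<close>
    hence "(M + mat (- z)) ** poly_mat q M = poly_mat q M ** (M + mat (- z))"
      unfolding poly_mat_def matmul.sum_left matmul.sum_right
      by (intro sum.cong refl) (metis mat_commute matrix_mul_assoc)
    also have "\<dots> = 0" using p q by (simp add: P_def poly_mat_mult_linear del: mult_pCons_right)
    finally have 0: "(M + mat (- z)) ** poly_mat q M = 0" .
    from \<open>poly_mat q M \<noteq> 0\<close> obtain w where w: "poly_mat q M *v w \<noteq> 0"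
      by (metis matrix_vector_mult_0 matrix_eq)
    have "(M + mat (- z)) *v (poly_mat q M *v w) = 0"
      using 0 by (simp add: matrix_vector_mul_assoc)
    moreover have "(M + mat (- z)) *v v = M *v v - z *s v" for v
    proof -
      have "mat (- z) *v v = - (z *s v)"
        by (simp add: vec_eq_iff matrix_vector_mult_def mat_def if_distrib if_distribR cong: if_cong)
      thus ?thesis by (simp add: matrix_vector_mult_add_rdistrib)
    qed
    ultimately show ?thesis using w by (metis eq_iff_diff_eq_0)
  qed
  with p(1) that show ?thesis unfolding P_def by blast
qed

text \<open>Induction on the degree, removing one root \<open>\<lambda>\<close> at a time: the derivative of
  \<open>e\<^sup>u\<^sup>(\<^sup>\<lambda>\<^sup>-\<^sup>M\<^sup>)X\<close> is controlled by the induction hypothesis for \<open>(M - \<lambda>I)X\<close>.\<close>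

lemma mat_exp_decay_aux:
  fixes M X :: "complex^'r^'r"
  assumes "p \<noteq> 0" "\<And>z. poly p z = 0 \<Longrightarrow> Re z > \<delta>" "poly_mat p M ** X = 0"
  shows "\<exists>C. \<forall>u\<ge>0. norm (mat_exp (u *\<^sub>R (- M)) ** X) \<le> C * exp (- \<delta> * u)"
  using assms
proof (induction "degree p" arbitrary: p X)
  case 0
  then obtain c where c: "p = [:c:]" "c \<noteq> 0" by (metis degree_eq_zeroE pCons_eq_0_iff)
  hence "mat (inverse c) ** (mat c ** X) = 0"
    using 0 by (simp add: poly_mat_const matmul.zero_right)
  hence "X = 0" using c by (simp add: matrix_mul_assoc mat_mult_mat)
  thus ?case by (intro exI[of _ 0]) (simp add: matmul.zero_right)
next
  case (Suc n)
  have "\<not> constant (poly p)" using Suc.hyps(2) by (simp add: constant_degree)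
  then obtain l where l: "poly p l = 0" using Fundamental_Theorem_Algebra.fundamental_theorem_of_algebra by blast
  then obtain q where q: "p = q * [:- l, 1:]" by (metis poly_eq_0_iff_dvd dvdE mult.commute)
  have l': "Re l > \<delta>" using Suc.prems l by blast
  have q0: "q \<noteq> 0" using q Suc.prems by auto
  have dq: "n = degree q" using q q0 Suc.hyps(2) by (simp add: degree_mult_eq del: mult_pCons_right)
  define X' where "X' = (M + mat (- l)) ** X"
  have "poly_mat q M ** X' = 0"
    using Suc.prems(3) unfolding X'_def q by (simp add: poly_mat_mult_linear matrix_mul_assoc del: mult_pCons_right)
  moreover have "Re z > \<delta>" if "poly q z = 0" for z
    using Suc.prems(2)[of z] that by (simp add: q del: mult_pCons_right)
  ultimately obtain C where C: "\<And>u. u \<ge> 0 \<Longrightarrow> norm (mat_exp (u *\<^sub>R (- M)) ** X') \<le> C * exp (- \<delta> * u)"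
    using Suc.hyps(1)[OF dq q0] by blast
  define L where "L = mat l - M"
  \<comment> \<open>Since \<delta> lies strictly below Re l, this gap is positive, and integrating
    \<open>C * exp (a * s)\<close> costs only the factor 1 / a. Multiple roots thus produce no
    powers of u, only a larger constant.\<close>
  define a where "a = Re l - \<delta>"
  have a: "a > 0" using l' by (simp add: a_def)
  have eL: "mat_exp (u *\<^sub>R L) = mat (exp (u * l)) ** mat_exp (u *\<^sub>R (- M))" for u :: real
    by (simp add: L_def scaleR_diff_right scaleR_mat add.commute[of _ "mat _"] flip: mat_exp_add_mat)
  have der: "((\<lambda>u. mat_exp (u *\<^sub>R L) ** X) has_vector_derivative (L ** mat_exp (u *\<^sub>R L)) ** X)
      (at u within S)" for u S
    using bounded_linear.has_vector_derivative[OF matmul.bounded_linear_left mat_exp_has_vector_derivative] .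
  have LX: "(L ** mat_exp (u *\<^sub>R L)) ** X = - (mat_exp (u *\<^sub>R L) ** X')" for u
  proof -
    have "L ** mat_exp (u *\<^sub>R L) = mat_exp (u *\<^sub>R L) ** L"
      by (rule mat_exp_commute) (simp add: matmul.scaleR_left matmul.scaleR_right)
    moreover have "X' = - (L ** X)"
      by (simp add: X'_def L_def mat_uminus matmul.add_left matmul.diff_left)
    ultimately show ?thesis by (simp add: matmul.minus_right matrix_mul_assoc)
  qed
  have bound: "norm ((L ** mat_exp (u *\<^sub>R L)) ** X) \<le> C * exp (a * u)" if "u \<ge> 0" for u
  proof -
    have "norm ((L ** mat_exp (u *\<^sub>R L)) ** X) = exp (u * Re l) * norm (mat_exp (u *\<^sub>R (- M)) ** X')"
      by (subst LX) (simp add: eL norm_mat_mult flip: matrix_mul_assoc)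
    also have "\<dots> \<le> exp (u * Re l) * (C * exp (- \<delta> * u))"
      by (intro mult_left_mono C that) simp
    also have "\<dots> = C * exp (a * u)" by (simp add: a_def algebra_simps flip: exp_add)
    finally show ?thesis .
  qed
  have C0: "C \<ge> 0" using C[of 0] norm_ge_zero order_trans by (metis exp_zero mult.right_neutral mult_zero_right order_refl)
  have main: "norm (mat_exp (u *\<^sub>R L) ** X) \<le> (norm X + C / a) * exp (a * u)" if u: "u \<ge> 0" for u
  proof (cases "u = 0")
    case True
    thus ?thesis using a C0 by simp
  next
    case False
    hence "u > 0" using u by simp
    have "norm (mat_exp (u *\<^sub>R L) ** X - mat_exp (0 *\<^sub>R L) ** X) \<le> C / a * exp (a * u) - C / a * exp (a * 0)"
    proof (rule differentiable_bound_general[OF \<open>u > 0\<close>])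
      show "continuous_on {0..u} (\<lambda>u. mat_exp (u *\<^sub>R L) ** X)"
        by (rule continuous_on_vector_derivative[OF der])
      show "continuous_on {0..u} (\<lambda>u. C / a * exp (a * u))"
        by (intro continuous_intros)
      show "((\<lambda>u. mat_exp (u *\<^sub>R L) ** X) has_vector_derivative (L ** mat_exp (s *\<^sub>R L)) ** X) (at s)" for s
        by (rule der)
      show "((\<lambda>u. C / a * exp (a * u)) has_vector_derivative C * exp (a * s)) (at s)" for s
        using a by (auto intro!: derivative_eq_intros simp flip: has_real_derivative_iff_has_vector_derivative)
      show "norm (L ** mat_exp (s *\<^sub>R L) ** X) \<le> C * exp (a * s)" if "0 < s" for s
        using bound that by simp
    qed
    hence "norm (mat_exp (u *\<^sub>R L) ** X) \<le> norm X + C / a * exp (a * u)"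
      using norm_triangle_sub[of "mat_exp (u *\<^sub>R L) ** X" X] divide_nonneg_pos[OF C0 a] by simp
    also have "norm X \<le> norm X * exp (a * u)" using a u by (simp add: mult_le_cancel_left1)
    finally show ?thesis by (simp add: algebra_simps)
  qed
  have "norm (mat_exp (u *\<^sub>R (- M)) ** X) \<le> (norm X + C / a) * exp (- \<delta> * u)" if "u \<ge> 0" for u
  proof -
    have "exp (u * Re l) * norm (mat_exp (u *\<^sub>R (- M)) ** X) = norm (mat_exp (u *\<^sub>R L) ** X)"
      by (simp add: eL norm_mat_mult flip: matrix_mul_assoc)
    also have "\<dots> \<le> (norm X + C / a) * exp (a * u)" by (rule main[OF that])
    also have "\<dots> = exp (u * Re l) * ((norm X + C / a) * exp (- \<delta> * u))"
      by (simp add: a_def algebra_simps flip: exp_add)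
    finally show ?thesis by (simp del: exp_ge_zero)
  qed
  thus ?case by blast
qed

lemma positive_stable_decay:
  fixes M :: "complex^'r^'r"
  assumes "positive_stable M"
  obtains C \<delta> where "\<delta> > 0" "C \<ge> 0" "\<And>u. u \<ge> 0 \<Longrightarrow> norm (mat_exp (- u *\<^sub>R M)) \<le> C * exp (- \<delta> * u)"
proof -
  obtain p where p: "p \<noteq> 0" "poly_mat p M = 0" "\<And>z. poly p z = 0 \<Longrightarrow> \<exists>v. v \<noteq> 0 \<and> M *v v = z *s v"
    using annihilating_poly_eigenvalues by blast
  \<comment> \<open>Halving makes \<delta> strictly smaller than every real part, as the preceding
    lemma demands; the inserted 1 makes the minimum meaningful without an argument that roots
    exist.\<close>
  define \<delta> where "\<delta> = Min (insert 1 (Re ` {z. poly p z = 0})) / 2"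
  have fin: "finite {z. poly p z = 0}" using p(1) by (rule poly_roots_finite)
  have pos: "Re z > 0" if "poly p z = 0" for z
    using p(3)[OF that] assms unfolding positive_stable_def by blast
  have 1: "Min (insert 1 (Re ` {z. poly p z = 0})) > 0" using fin pos by (subst Min_gr_iff) auto
  have 2: "Re z > \<delta>" if "poly p z = 0" for z
  proof -
    have "Min (insert 1 (Re ` {z. poly p z = 0})) \<le> Re z" using fin that by (intro Min_le) auto
    thus ?thesis using 1 pos[OF that] unfolding \<delta>_def by linarith
  qed
  obtain C where C: "\<And>u. u \<ge> 0 \<Longrightarrow> norm (mat_exp (u *\<^sub>R (- M)) ** mat 1) \<le> C * exp (- \<delta> * u)"
    using mat_exp_decay_aux[OF p(1) 2, of M "mat 1"] p(2) by (auto simp: matmul.zero_left)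
  show ?thesis
  proof (rule that[of \<delta> C])
    show "\<delta> > 0" using 1 by (simp add: \<delta>_def)
    show "C \<ge> 0" using order_trans[OF norm_ge_zero C[of 0]] by simp
    show "norm (mat_exp (- u *\<^sub>R M)) \<le> C * exp (- \<delta> * u)" if "u \<ge> 0" for u
      using C[OF that] by simp
  qed
qed

section \<open>Size of s^(M - I) for s > 0\<close>

lemma mat_powr_diff_mat_1:
  assumes "s > 0"
  shows "mat_powr s (M - mat 1) = (1 / s) *\<^sub>R mat_powr s M"
proof -
  have "ln s *\<^sub>R (M - mat 1) = ln s *\<^sub>R M + mat (of_real (- ln s))"
    by (simp add: scaleR_diff_right scaleR_mat mat_uminus)
  moreover have "exp (complex_of_real (- ln s)) = of_real (1 / s)"
    using assms by (simp add: exp_minus exp_of_real divide_inverse)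
  ultimately show ?thesis
    by (simp only: mat_powr_def mat_exp_add_mat scaleR_conv_mat)
qed

text \<open>For s \<le> 1 the exponential decay is used at u = - ln s \<ge> 0 and gives s^\<delta>;
  for s > 1 the crude bound gives s^L. The sum of both serves all s at once. Enlarging L to at least
  \<delta> makes it positive and lets the \<delta>-term dominate on the unit interval.\<close>

lemma mat_powr_bound:
  fixes M :: "complex^'r^'r"
  assumes "positive_stable M"
  obtains C \<delta> L where "\<delta> > 0" "C \<ge> 0" "L \<ge> \<delta>"
    "\<And>s. s > 0 \<Longrightarrow> norm (mat_powr s (M - mat 1)) \<le> C * (s powr (\<delta> - 1) + s powr (L - 1))"
proof -
  obtain C \<delta> where C: "\<delta> > 0" "C \<ge> 0" "\<And>u. u \<ge> 0 \<Longrightarrow> norm (mat_exp (- u *\<^sub>R M)) \<le> C * exp (- \<delta> * u)"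
    using positive_stable_decay[OF assms] by metis
  obtain L where L: "L > 0" "\<And>u. norm (mat_exp (u *\<^sub>R M)) \<le> norm (mat 1 :: complex^'r^'r) * exp (L * \<bar>u\<bar>)"
    using norm_mat_exp_le[of M] by metis
  define D where "D = max C (norm (mat 1 :: complex^'r^'r))"
  define L' where "L' = max L \<delta>"
  have D: "D \<ge> 0" "C \<le> D" "norm (mat 1 :: complex^'r^'r) \<le> D" using C by (auto simp: D_def)
  have "norm (mat_powr s M) \<le> D * (s powr \<delta> + s powr L')" if s: "s > 0" for s
  proof (cases "s \<le> 1")
    case True
    have "norm (mat_powr s M) \<le> C * exp (- \<delta> * (- ln s))"
      using C(3)[of "- ln s"] s True by (simp add: mat_powr_def)
    also have "\<dots> = C * s powr \<delta>" using s by (simp add: powr_def)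
    also have "\<dots> \<le> D * (s powr \<delta> + s powr L')" using D C by (intro mult_mono) auto
    finally show ?thesis .
  next
    case False
    have "norm (mat_powr s M) \<le> norm (mat 1 :: complex^'r^'r) * exp (L * ln s)"
      using L(2)[of "ln s"] False by (simp add: mat_powr_def)
    also have "\<dots> = norm (mat 1 :: complex^'r^'r) * s powr L" using s by (simp add: powr_def)
    also have "\<dots> \<le> D * (s powr \<delta> + s powr L')"
    proof (intro mult_mono)
      show "s powr L \<le> s powr \<delta> + s powr L'"
        using powr_mono[of L L' s] False by (simp add: L'_def add_increasing)
    qed (use D in auto)
    finally show ?thesis .
  qed
  hence "norm (mat_powr s (M - mat 1)) \<le> D * (s powr (\<delta> - 1) + s powr (L' - 1))" if "s > 0" for s
    using that by (simp add: mat_powr_diff_mat_1 powr_diff divide_simps algebra_simps)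
  with C(1) D(1) show ?thesis by (intro that[of \<delta> D L']) (auto simp: L'_def)
qed

subsection \<open>The matrix gamma function\<close>

lemma set_integrable_bounded_linear:
  fixes f :: "'a \<Rightarrow> 'b::{banach,second_countable_topology}"
    and T :: "'b \<Rightarrow> 'c::{banach,second_countable_topology}"
  assumes "bounded_linear T" "set_integrable M A f"
  shows "set_integrable M A (\<lambda>x. T (f x))"
    and "(LINT x:A|M. T (f x)) = T (LINT x:A|M. f x)"
proof -
  interpret T: bounded_linear T by fact
  have eq: "indicator A x *\<^sub>R T (f x) = T (indicator A x *\<^sub>R f x)" for x
    by (simp add: T.scaleR)
  show "set_integrable M A (\<lambda>x. T (f x))"
    using assms(2) unfolding set_integrable_def eq by (rule integrable_bounded_linear[OF assms(1)])
  show "(LINT x:A|M. T (f x)) = T (LINT x:A|M. f x)"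
    using assms(2) unfolding set_integrable_def set_lebesgue_integral_def eq
    by (rule integral_bounded_linear[OF assms(1)])
qed

lemma measurable_matrix_mult [measurable]:
  fixes f :: "'a \<Rightarrow> complex^'n^'m" and g :: "'a \<Rightarrow> complex^'p^'n"
  assumes "f \<in> borel_measurable N" "g \<in> borel_measurable N"
  shows "(\<lambda>x. f x ** g x) \<in> borel_measurable N"
  using assms
  by (rule borel_measurable_continuous_Pair) (intro matmul.continuous_on continuous_intros)

lemma continuous_on_mat_exp: "continuous_on S (\<lambda>u. mat_exp (u *\<^sub>R A))"
  by (rule continuous_on_vector_derivative[OF mat_exp_has_vector_derivative])

lemma measurable_mat_powr [measurable]:
  assumes [measurable]: "f \<in> borel_measurable N"
  shows "(\<lambda>x. mat_powr (f x) M) \<in> borel_measurable N"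
proof -
  have [measurable]: "(\<lambda>u. mat_exp (u *\<^sub>R M)) \<in> borel_measurable borel"
    by (intro borel_measurable_continuous_onI continuous_on_mat_exp)
  show ?thesis unfolding mat_powr_def by measurable
qed

lemma mat_powr_has_vector_derivative:
  assumes "s > 0"
  shows "((\<lambda>s. mat_powr s M) has_vector_derivative M ** mat_powr s (M - mat 1)) (at s)"
proof -
  have "((\<lambda>u. mat_exp (u *\<^sub>R M)) \<circ> ln has_vector_derivative (1 / s) *\<^sub>R (M ** mat_exp (ln s *\<^sub>R M))) (at s)"
    using assms
    by (intro vector_diff_chain_at mat_exp_has_vector_derivative)
       (auto simp flip: has_real_derivative_iff_has_vector_derivative intro!: derivative_eq_intros)
  thus ?thesis using assms
    unfolding mat_powr_diff_mat_1[OF assms] by (simp add: mat_powr_def o_def matmul.scaleR_right)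
qed

lemma continuous_on_mat_powr: "S \<subseteq> {0<..} \<Longrightarrow> continuous_on S (\<lambda>s. mat_powr s M)"
  by (rule continuous_at_imp_continuous_on)
     (auto intro!: has_vector_derivative_continuous mat_powr_has_vector_derivative)

lemma mat_powr_commute: "X ** M = M ** X \<Longrightarrow> X ** mat_powr s M = mat_powr s M ** X"
  unfolding mat_powr_def
  by (rule mat_exp_commute) (simp add: matmul.scaleR_left matmul.scaleR_right)

lemma mat_powr_add:
  "A ** B = B ** A \<Longrightarrow> mat_powr s (A + B) = mat_powr s A ** mat_powr s B"
  unfolding mat_powr_def scaleR_add_right
  by (rule mat_exp_add) (simp add: matmul.scaleR_left matmul.scaleR_right)

lemma mat_powr_add_of_nat:
  assumes "s > 0"
  shows "mat_powr s (A + mat (of_nat n)) = s ^ n *\<^sub>R mat_powr s A"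
proof -
  have "exp (complex_of_real (ln s) * of_nat n) = of_real (s ^ n)"
    using assms by (simp add: mult.commute[of _ "of_nat n"] exp_of_nat_mult exp_of_real flip: of_real_power)
  thus ?thesis
    by (simp add: mat_powr_def scaleR_add_right scaleR_mat mat_exp_add_mat scaleR_conv_mat[of "s ^ n"])
qed

lemma mat_powr_mult:
  assumes "s > 0" "t > 0"
  shows "mat_powr (s * t) A = mat_powr s A ** mat_powr t A"
  using assms unfolding mat_powr_def
  by (simp add: ln_mult scaleR_add_left mat_exp_add matmul.scaleR_left matmul.scaleR_right)

section \<open>Convergence and functional equation of the matrix gamma integral\<close>

lemma integrable_Gamma_real:
  assumes "(a :: real) > 0"
  shows "set_integrable lborel {0<..} (\<lambda>s. exp (- s) * s powr (a - 1))"
proof -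
  have "(\<lambda>t. complex_of_real t powr (of_real a - 1) / of_real (exp t)) absolutely_integrable_on {0<..}"
    using assms by (intro absolutely_integrable_Gamma_integral') simp
  hence "(\<lambda>t. norm (complex_of_real t powr (of_real a - 1) / of_real (exp t))) absolutely_integrable_on {0<..}"
    by (rule set_integrable_norm)
  also have "?this \<longleftrightarrow> (\<lambda>s. exp (- s) * s powr (a - 1)) absolutely_integrable_on {0<..}"
    by (intro set_integrable_cong)
       (auto simp: norm_divide norm_powr_real_powr exp_minus field_simps)
  finally show ?thesis
    unfolding set_integrable_def by (subst (asm) integrable_completion) auto
qed

lemma mat_Gamma_integrable:
  fixes M :: "complex^'r^'r"
  assumes "positive_stable M"
  shows "set_integrable lborel {0<..} (\<lambda>s. exp (- s) *\<^sub>R mat_powr s (M - mat 1))"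
proof -
  obtain C \<delta> L where C: "\<delta> > 0" "C \<ge> 0" "L \<ge> \<delta>"
    "\<And>s. s > 0 \<Longrightarrow> norm (mat_powr s (M - mat 1)) \<le> C * (s powr (\<delta> - 1) + s powr (L - 1))"
    using mat_powr_bound[OF assms] by metis
  have "set_integrable lborel {0<..} (\<lambda>s. C * (exp (- s) * s powr (\<delta> - 1) + exp (- s) * s powr (L - 1)))"
    using C by (intro set_integrable_mult_right set_integral_add integrable_Gamma_real) auto
  thus ?thesis
  proof (rule set_integrable_bound)
    show "set_borel_measurable lborel {0<..} (\<lambda>s. exp (- s) *\<^sub>R mat_powr s (M - mat 1))"
      unfolding set_borel_measurable_def by measurable
    have "exp (- s) * norm (mat_powr s (M - mat 1)) \<le> exp (- s) * (C * (s powr (\<delta> - 1) + s powr (L - 1)))"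
      if "s > 0" for s
      using C(4)[OF that] by (intro mult_left_mono) auto
    thus "AE s in lborel. s \<in> {0<..} \<longrightarrow> norm (exp (- s) *\<^sub>R mat_powr s (M - mat 1))
        \<le> norm (C * (exp (- s) * s powr (\<delta> - 1) + exp (- s) * s powr (L - 1)))"
      using C(2) by (intro AE_I2) (auto simp: algebra_simps)
  qed
qed

lemma positive_stable_add_of_nat:
  assumes "positive_stable M"
  shows "positive_stable (M + mat (of_nat n))"
  unfolding positive_stable_def
proof safe
  fix l v assume v: "v \<noteq> 0" "(M + mat (of_nat n)) *v v = l *s v"
  have "mat (of_nat n) *v v = of_nat n *s v"
    by (simp add: vec_eq_iff matrix_vector_mult_def mat_def if_distrib if_distribR cong: if_cong)
  hence "M *v v = (l - of_nat n) *s v"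
    using v(2) by (simp add: matrix_vector_mult_add_rdistrib vector_sub_rdistrib eq_diff_eq)
  with v(1) assms have "Re (l - of_nat n) > 0" unfolding positive_stable_def by blast
  thus "Re l > 0" by simp
qed

lemma positive_stable_invertible:
  assumes "positive_stable M"
  shows "invertible M"
  unfolding invertible_left_inverse matrix_left_invertible_ker
  using assms unfolding positive_stable_def by (metis less_irrefl vector_smult_lzero zero_complex.sel(1))

text \<open>Integration by parts in the form of the fundamental theorem: \<open>F s\<close>, which
  is e^(-s) s^M, has derivative \<open>g s - f s\<close> and vanishes at both ends, at 0 because the
  exponents \<delta> and L are positive. Since \<open>f\<close> and \<open>g\<close> are separately
  integrable, their integrals agree.\<close>

lemma mat_Gamma_add_1:
  fixes M :: "complex^'r^'r"
  assumes "positive_stable M"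
  shows "mat_Gamma (M + mat 1) = M ** mat_Gamma M"
proof -
  define f g where "f s = exp (- s) *\<^sub>R mat_powr s (M + mat 1 - mat 1)"
    and "g s = M ** (exp (- s) *\<^sub>R mat_powr s (M - mat 1))" for s
  have "positive_stable (M + mat 1)" using positive_stable_add_of_nat[OF assms, of 1] by simp
  hence f: "set_integrable lborel {0<..} f" and fI: "(LINT s:{0<..}|lborel. f s) = mat_Gamma (M + mat 1)"
    unfolding f_def mat_Gamma_def by (simp_all only: mat_Gamma_integrable)
  have g: "set_integrable lborel {0<..} g" and gI: "(LINT s:{0<..}|lborel. g s) = M ** mat_Gamma M"
    unfolding g_def mat_Gamma_def
    by (rule set_integrable_bounded_linear[OF matmul.bounded_linear_right mat_Gamma_integrable[OF assms]])+
  have fg: "set_integrable lborel {0<..} (\<lambda>s. g s - f s)"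
    and fgI: "(LINT s:{0<..}|lborel. g s - f s) = M ** mat_Gamma M - mat_Gamma (M + mat 1)"
    using f g fI gI by auto
  define F where "F s = exp (- s) *\<^sub>R mat_powr s M" for s
  obtain C \<delta> L where C: "\<delta> > 0" "C \<ge> 0" "L \<ge> \<delta>"
    "\<And>s. s > 0 \<Longrightarrow> norm (mat_powr s (M - mat 1)) \<le> C * (s powr (\<delta> - 1) + s powr (L - 1))"
    using mat_powr_bound[OF assms] by metis
  have F_bound: "norm (F s) \<le> C * (exp (- s) * (s powr \<delta> + s powr L))" if "s > 0" for s
  proof -
    have "norm (F s) = exp (- s) * (s * norm (mat_powr s (M - mat 1)))"
      using that by (simp add: F_def mat_powr_diff_mat_1)
    also have "\<dots> \<le> exp (- s) * (s * (C * (s powr (\<delta> - 1) + s powr (L - 1))))"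
      using that by (intro mult_left_mono C) auto
    also have "\<dots> = C * (exp (- s) * (s powr \<delta> + s powr L))"
      using that by (simp add: powr_diff algebra_simps)
    finally show ?thesis .
  qed
  have "L > 0" using C by simp
  have "((\<lambda>s. exp (- s) * s powr a) \<longlongrightarrow> 0) (at_right 0)"
       "((\<lambda>s. exp (- s) * s powr a) \<longlongrightarrow> 0) at_top" if "a > 0" for a :: real
    using that by real_asymp+
  note lim = this[OF C(1)] this[OF \<open>L > 0\<close>]
  have lim0: "((\<lambda>s. C * (exp (- s) * (s powr \<delta> + s powr L))) \<longlongrightarrow> 0) (at_right 0)"
    using tendsto_add[OF lim(1) lim(3)] by (intro tendsto_mult_right_zero) (simp add: algebra_simps)
  have lim1: "((\<lambda>s. C * (exp (- s) * (s powr \<delta> + s powr L))) \<longlongrightarrow> 0) at_top"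
    using tendsto_add[OF lim(2) lim(4)] by (intro tendsto_mult_right_zero) (simp add: algebra_simps)
  have "(LBINT s=0..\<infinity>. g s - f s) = 0 - 0"
  proof (rule interval_integral_FTC_integrable[of 0 \<infinity> F])
    show "(F has_vector_derivative g s - f s) (at s)" if "0 < ereal s" for s
    proof -
      have "s > 0" using that by simp
      have "(F has_vector_derivative exp (- s) *\<^sub>R (M ** mat_powr s (M - mat 1)) + (- exp (- s)) *\<^sub>R mat_powr s M) (at s)"
        unfolding F_def using \<open>s > 0\<close>
        by (intro has_vector_derivative_scaleR mat_powr_has_vector_derivative) (auto intro!: derivative_eq_intros)
      thus ?thesis by (simp add: f_def g_def matmul.scaleR_right)
    qed
    show "isCont (\<lambda>s. g s - f s) s" if "0 < ereal s" for s
    proof -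
      have "continuous_on {0<..} (\<lambda>s. g s - f s)"
        unfolding f_def g_def
        by (intro continuous_intros matmul.continuous_on continuous_on_mat_powr order_refl)
      thus ?thesis using that by (simp add: continuous_on_eq_continuous_at)
    qed
    show "set_integrable lborel (einterval 0 \<infinity>) (\<lambda>s. g s - f s)"
      using fg by (simp add: zero_ereal_def)
    have "(F \<longlongrightarrow> 0) (at_right 0)"
      by (rule Lim_null_comparison[OF _ lim0])
         (use F_bound in \<open>auto simp: eventually_at_filter intro!: always_eventually\<close>)
    thus "((F \<circ> real_of_ereal) \<longlongrightarrow> 0) (at_right 0)"
      by (simp add: zero_ereal_def ereal_tendsto_simps)
    have "(F \<longlongrightarrow> 0) at_top"
      by (rule Lim_null_comparison[OF _ lim1], rule eventually_mono[OF eventually_gt_at_top[of 0]])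
         (use F_bound in auto)
    thus "((F \<circ> real_of_ereal) \<longlongrightarrow> 0) (at_left \<infinity>)"
      by (simp add: ereal_tendsto_simps)
  qed simp
  hence "(LINT s:{0<..}|lborel. g s - f s) = 0"
    by (simp add: interval_lebesgue_integral_def zero_ereal_def)
  thus ?thesis using fgI by simp
qed

lemma mat_pochhammer_commute:
  assumes "X ** M = M ** X"
  shows "X ** mat_pochhammer M n = mat_pochhammer M n ** X"
proof (induction n)
  case (Suc n)
  have "X ** (M + mat c) = (M + mat c) ** X" for c
    using assms by (simp add: matmul.add_left matmul.add_right mat_commute)
  thus ?case using Suc by (simp add: matrix_mul_assoc) (metis matrix_mul_assoc)
qed simp

lemma mat_Gamma_add_of_nat:
  fixes M :: "complex^'r^'r"
  assumes "positive_stable M"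
  shows "mat_Gamma (M + mat (of_nat n)) = mat_pochhammer M n ** mat_Gamma M"
proof (induction n)
  case (Suc n)
  have "mat (of_nat (Suc n)) = (mat (of_nat n) + mat 1 :: complex^'r^'r)"
    by (simp add: add.commute flip: mat_add)
  hence "mat_Gamma (M + mat (of_nat (Suc n))) = mat_Gamma (M + mat (of_nat n) + mat 1)"
    by (simp add: add.assoc)
  also have "\<dots> = (M + mat (of_nat n)) ** mat_pochhammer M n ** mat_Gamma M"
    by (simp add: mat_Gamma_add_1 positive_stable_add_of_nat assms Suc matrix_mul_assoc)
  also have "(M + mat (of_nat n)) ** mat_pochhammer M n = mat_pochhammer M (Suc n)"
    using mat_pochhammer_commute[of M M n] by (simp add: matmul.add_left matmul.add_right mat_commute)
  finally show ?case .
qed simp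

lemma invertible_mat_pochhammer:
  assumes "\<And>k. invertible (M + mat (of_nat k))"
  shows "invertible (mat_pochhammer M n)"
proof (induction n)
  case 0
  show ?case by (auto simp: invertible_def intro: exI[of _ "mat 1"])
qed (auto intro: assms invertible_mult)

subsection \<open>The reciprocal gamma function of a matrix\<close>

text \<open>Expanding s^M = e^(M ln s) and integrating against e^(-s) s^(c-1) term by term gives the
  moments \<open>a k\<close>, the Taylor coefficients of \<Gamma> at c. The vectors
  \<open>X k\<close> are left abstract so that the powers of a complex number and those of a matrix
  receive literally the same coefficients.\<close>

lemma Gamma_moment_series:
  fixes X :: "nat \<Rightarrow> 'b::{banach, second_countable_topology}" and c :: real
  assumes L: "0 < L" "L < c" and X: "\<And>k. norm (X k) \<le> K * L ^ k"
  defines "a \<equiv> (\<lambda>k. (LINT s:{0<..}|lborel. exp (- s) * s powr (c - 1) * ln s ^ k) / fact k)"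
  shows "summable (\<lambda>k. norm (a k *\<^sub>R X k))"
    and "(\<lambda>k. a k *\<^sub>R X k) sums
      (LINT s:{0<..}|lborel. (exp (- s) * s powr (c - 1)) *\<^sub>R (\<Sum>k. (ln s ^ k / fact k) *\<^sub>R X k))"
proof -
  have K: "K \<ge> 0" using order_trans[OF norm_ge_zero X[of 0]] by simp
  define w where "w s = exp (- s) * s powr (c - 1)" for s :: real
  have w0: "w s \<ge> 0" for s by (simp add: w_def)
  have [measurable]: "w \<in> borel_measurable borel" unfolding w_def by measurable
  define g where "g k s = w s * (L * \<bar>ln s\<bar>) ^ k / fact k" for k s
  \<comment> \<open>The majorant comes from e^(L |ln s|) \<le> s^L + s^(-L); it is integrable at 0
    because L < c.\<close>
  define h where "h s = exp (- s) * s powr (c + L - 1) + exp (- s) * s powr (c - L - 1)" for s :: real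
  have h: "set_integrable lborel {0<..} h"
    unfolding h_def using L by (intro set_integral_add integrable_Gamma_real) auto
  have g_sums: "(\<lambda>k. g k s) sums (w s * exp (L * \<bar>ln s\<bar>))" for s
    using sums_mult[OF exp_converges[of "L * \<bar>ln s\<bar>"], of "w s"]
    by (simp add: g_def divide_inverse mult_ac)
  have g0: "g k s \<ge> 0" for k s using L w0 by (simp add: g_def)
  have wh: "w s * exp (L * \<bar>ln s\<bar>) \<le> h s" if "s > 0" for s
  proof -
    have "exp (L * \<bar>ln s\<bar>) \<le> s powr L + s powr (- L)"
      using that by (cases "ln s \<ge> 0") (simp_all add: powr_def)
    hence "w s * exp (L * \<bar>ln s\<bar>) \<le> w s * (s powr L + s powr (- L))"
      by (intro mult_left_mono w0)
    also have "\<dots> = h s"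
      by (simp add: w_def h_def distrib_left mult.assoc flip: powr_add) (simp add: algebra_simps)
    finally show ?thesis .
  qed
  have gsum_le: "(\<Sum>k<n. g k s) \<le> h s" if "s > 0" for n s
    using sum_le_suminf[of "\<lambda>k. g k s" "{..<n}"] g_sums[of s] g0 wh[OF that]
    by (force simp: sums_iff)
  have g_int: "set_integrable lborel {0<..} (g k)" for k
    using h
  proof (rule set_integrable_bound)
    show "set_borel_measurable lborel {0<..} (g k)"
      unfolding set_borel_measurable_def g_def by measurable
    have "norm (g k s) \<le> norm (h s)" if "s > 0" for s
    proof -
      have "g k s \<le> (\<Sum>k<Suc k. g k s)" using g0 by (simp add: sum_nonneg)
      thus ?thesis using gsum_le[OF that, of "Suc k"] g0[of k s] by simp
    qed
    thus "AE s in lborel. s \<in> {0<..} \<longrightarrow> norm (g k s) \<le> norm (h s)" by simp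
  qed
  have g_summable: "summable (\<lambda>k. LINT s:{0<..}|lborel. g k s)"
  proof (rule summableI_nonneg_bounded)
    show "0 \<le> (LINT s:{0<..}|lborel. g k s)" for k
      using g0 by (simp add: set_lebesgue_integral_def integral_nonneg_AE)
    have "(\<Sum>k<n. LINT s:{0<..}|lborel. g k s) = (LINT s:{0<..}|lborel. (\<Sum>k<n. g k s))" for n
      using g_int unfolding set_integrable_def set_lebesgue_integral_def
      unfolding scaleR_sum_right by (rule Bochner_Integration.integral_sum[symmetric])
    also have "\<dots> n \<le> (LINT s:{0<..}|lborel. h s)" for n
    proof (rule set_integral_mono[OF _ h gsum_le])
      show "set_integrable lborel {0<..} (\<lambda>s. \<Sum>k<n. g k s)"
        using g_int unfolding set_integrable_def scaleR_sum_right
        by (intro Bochner_Integration.integrable_sum)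
    qed auto
    finally show "(\<Sum>k<n. LINT s:{0<..}|lborel. g k s) \<le> (LINT s:{0<..}|lborel. h s)" for n .
  qed
  define f where "f k s = (w s * ln s ^ k / fact k) *\<^sub>R X k" for k s
  have f_bound: "norm (f k s) \<le> K * g k s" for k s
  proof -
    have "norm (f k s) = w s * \<bar>ln s\<bar> ^ k / fact k * norm (X k)"
      using w0 by (simp add: f_def abs_mult power_abs)
    also have "\<dots> \<le> w s * \<bar>ln s\<bar> ^ k / fact k * (K * L ^ k)"
      using w0 by (intro mult_left_mono X) auto
    finally show ?thesis by (simp add: g_def power_mult_distrib mult_ac)
  qed
  have f_int: "set_integrable lborel {0<..} (f k)" for k
    using set_integrable_mult_right[OF g_int, of K k]
  proof (rule set_integrable_bound)
    show "set_borel_measurable lborel {0<..} (f k)"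
      unfolding set_borel_measurable_def f_def by measurable
    show "AE s in lborel. s \<in> {0<..} \<longrightarrow> norm (f k s) \<le> norm (K * g k s)"
      using f_bound order_trans[OF f_bound abs_ge_self] by (intro AE_I2) auto
  qed
  have norm_summable: "summable (\<lambda>k. LINT s:{0<..}|lborel. norm (f k s))"
  proof (rule summable_comparison_test')
    show "summable (\<lambda>k. K * (LINT s:{0<..}|lborel. g k s))" by (intro summable_mult g_summable)
    have "(LINT s:{0<..}|lborel. norm (f k s)) \<le> (LINT s:{0<..}|lborel. K * g k s)" for k
      by (intro set_integral_mono set_integrable_norm f_int set_integrable_mult_right g_int f_bound)
    moreover have "0 \<le> (LINT s:{0<..}|lborel. norm (f k s))" for k
      by (simp add: set_lebesgue_integral_def integral_nonneg_AE)
    ultimately show "norm (LINT s:{0<..}|lborel. norm (f k s)) \<le> K * (LINT s:{0<..}|lborel. g k s)" for k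
      by simp
  qed
  have pointwise: "summable (\<lambda>k. norm (f k s))" for s
  proof (rule summable_comparison_test')
    show "summable (\<lambda>k. K * g k s)" using g_sums[of s] by (intro summable_mult) (simp add: sums_iff)
  qed (use f_bound in auto)
  have f_val: "(LINT s:{0<..}|lborel. f k s) = a k *\<^sub>R X k" for k
  proof -
    \<comment> \<open>The k-th moment converges because |ln s|^k is a constant multiple of the k-th
      term of the majorant; here one divides by L^k, so L > 0 is used.\<close>
    have "set_integrable lborel {0<..} (\<lambda>s. w s * ln s ^ k)"
      using set_integrable_mult_right[OF g_int, of "fact k / L ^ k" k]
    proof (rule set_integrable_bound)
      show "set_borel_measurable lborel {0<..} (\<lambda>s. w s * ln s ^ k)"
        unfolding set_borel_measurable_def by measurable
      show "AE s in lborel. s \<in> {0<..} \<longrightarrow> norm (w s * ln s ^ k) \<le> norm (fact k / L ^ k * g k s)"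
        using L w0 by (intro AE_I2) (auto simp: g_def abs_mult power_abs power_mult_distrib)
    qed
    from set_integrable_bounded_linear(2)[OF bounded_linear_scaleR_left this, of "X k /\<^sub>R fact k"]
    show ?thesis by (simp add: f_def a_def w_def divide_inverse mult_ac)
  qed
  have "(\<lambda>k. \<integral>s. indicator {0<..} s *\<^sub>R f k s \<partial>lborel) sums
      (\<integral>s. (\<Sum>k. indicator {0<..} s *\<^sub>R f k s) \<partial>lborel)"
  proof (rule sums_integral)
    show "integrable lborel (\<lambda>s. indicator {0<..} s *\<^sub>R f k s)" for k
      using f_int by (simp add: set_integrable_def)
    show "AE s in lborel. summable (\<lambda>k. norm (indicator {0<..} s *\<^sub>R f k s))"
      using pointwise by (intro AE_I2) (simp add: summable_mult)
    show "summable (\<lambda>k. \<integral>s. norm (indicator {0<..} s *\<^sub>R f k s) \<partial>lborel)"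
      using norm_summable by (simp add: set_lebesgue_integral_def)
  qed
  hence "(\<lambda>k. a k *\<^sub>R X k) sums (LINT s:{0<..}|lborel. (\<Sum>k. f k s))"
    using pointwise[THEN summable_norm_cancel]
    by (simp add: suminf_scaleR_right set_lebesgue_integral_def flip: f_val)
  moreover have "(\<Sum>k. f k s) = w s *\<^sub>R (\<Sum>k. (ln s ^ k / fact k) *\<^sub>R X k)" if "s > 0" for s
  proof -
    \<comment> \<open>Dividing by the weight yields convergence of the inner series, which must be
      known before the weight can be pulled out of the sum.\<close>
    have "w s \<noteq> 0" using that by (simp add: w_def)
    hence "(ln s ^ k / fact k) *\<^sub>R X k = inverse (w s) *\<^sub>R f k s" for k by (simp add: f_def)
    hence "summable (\<lambda>k. (ln s ^ k / fact k) *\<^sub>R X k)"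
      using summable_scaleR_right[OF summable_norm_cancel[OF pointwise[of s]]] by simp
    from suminf_scaleR_right[OF this, of "w s"] show ?thesis by (simp add: f_def)
  qed
  hence "(LINT s:{0<..}|lborel. (\<Sum>k. f k s)) =
      (LINT s:{0<..}|lborel. w s *\<^sub>R (\<Sum>k. (ln s ^ k / fact k) *\<^sub>R X k))"
    by (intro set_lebesgue_integral_cong) auto
  ultimately show "(\<lambda>k. a k *\<^sub>R X k) sums
      (LINT s:{0<..}|lborel. (exp (- s) * s powr (c - 1)) *\<^sub>R (\<Sum>k. (ln s ^ k / fact k) *\<^sub>R X k))"
    by (simp add: w_def)
  show "summable (\<lambda>k. norm (a k *\<^sub>R X k))"
  proof (rule summable_comparison_test'[OF norm_summable])
    have "norm (a k *\<^sub>R X k) = norm (LINT s:{0<..}|lborel. f k s)" for k by (simp only: f_val)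
    also have "\<dots> k \<le> (LINT s:{0<..}|lborel. norm (f k s))" for k
      using integral_norm_bound[of lborel "\<lambda>s. indicator {0<..} s *\<^sub>R f k s"]
      by (simp add: set_lebesgue_integral_def)
    finally show "norm (norm (a k *\<^sub>R X k)) \<le> (LINT s:{0<..}|lborel. norm (f k s))" for k
      by simp
  qed
qed

lemma Gamma_moment_series_complex:
  fixes z :: complex and c :: real
  assumes "norm z < c"
  defines "a \<equiv> (\<lambda>k. (LINT s:{0<..}|lborel. exp (- s) * s powr (c - 1) * ln s ^ k) / fact k)"
  shows "summable (\<lambda>k. norm (of_real (a k) * z ^ k))"
    and "(\<lambda>k. of_real (a k) * z ^ k) sums Gamma (of_real c + z)"
proof -
  \<comment> \<open>The midpoint of |z| and c lies strictly below c and is positive even for z =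
    0.\<close>
  define L where "L = (norm z + c) / 2"
  have L: "norm z \<le> L" "0 < L" "L < c"
    using assms(1) le_less_trans[OF norm_ge_zero assms(1)] by (simp_all add: L_def add_nonneg_pos)
  have pow: "norm (z ^ k) \<le> 1 * L ^ k" for k using L by (simp add: norm_power power_mono)
  note series = Gamma_moment_series[OF L(2,3) pow]
  have "(\<Sum>k. (ln s ^ k / fact k) *\<^sub>R z ^ k) = exp (ln s *\<^sub>R z)" for s
    using exp_converges[of "ln s *\<^sub>R z"] by (simp add: sums_iff divide_inverse mult.commute)
  hence 1: "(exp (- s) * s powr (c - 1)) *\<^sub>R (\<Sum>k. (ln s ^ k / fact k) *\<^sub>R z ^ k) =
      of_real s powr (of_real c + z - 1) / of_real (exp s)" if "s > 0" for s
  proof -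
    have "s powr (c - 1) *\<^sub>R exp (ln s *\<^sub>R z) = of_real s powr (of_real (c - 1)) * of_real s powr z"
      using that by (simp add: powr_of_real powr_def scaleR_conv_of_real Ln_of_real mult.commute
          flip: exp_of_real)
    also have "\<dots> = of_real s powr (of_real c + z - 1)"
      using that by (simp add: algebra_simps flip: powr_add)
    finally show ?thesis
      using \<open>\<And>s. _ = exp (ln s *\<^sub>R z)\<close>
      by (simp add: exp_minus divide_inverse scaleR_conv_of_real mult_ac)
  qed
  have "Re (of_real c + z) > 0"
    using assms(1) abs_Re_le_cmod[of z] by simp
  note G = absolutely_integrable_Gamma_integral'[OF this] Gamma_integral_complex'[OF this]
  have "(LINT s:{0<..}|lborel. (exp (- s) * s powr (c - 1)) *\<^sub>R (\<Sum>k. (ln s ^ k / fact k) *\<^sub>R z ^ k))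
     = (LINT s:{0<..}|lborel. of_real s powr (of_real c + z - 1) / of_real (exp s))"
    using 1 by (intro set_lebesgue_integral_cong) auto
  also have "\<dots> = (LINT s:{0<..}|lebesgue. of_real s powr (of_real c + z - 1) / of_real (exp s))"
    unfolding set_lebesgue_integral_def by (rule integral_completion[symmetric]) measurable
  also have "\<dots> = Gamma (of_real c + z)"
    using G by (simp add: set_lebesgue_integral_eq_integral(2) integral_unique)
  finally have "(LINT s:{0<..}|lborel. (exp (- s) * s powr (c - 1)) *\<^sub>R (\<Sum>k. (ln s ^ k / fact k) *\<^sub>R z ^ k))
     = Gamma (of_real c + z)" .
  with series show "summable (\<lambda>k. norm (of_real (a k) * z ^ k))"
    "(\<lambda>k. of_real (a k) * z ^ k) sums Gamma (of_real c + z)"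
    by (simp_all add: a_def scaleR_conv_of_real)
qed

text \<open>The weight exponent is an integer n here, so that s^n combines with s^M into s^(M + nI).
  The bound \<open>L < real n\<close> makes the integral and the series converge.\<close>

lemma Gamma_moment_series_matrix:
  fixes M :: "complex^'r^'r"
  assumes L: "0 < L" "L < real n" "\<And>k. norm (mat_power M k) \<le> K * L ^ k"
  defines "a \<equiv> (\<lambda>k. (LINT s:{0<..}|lborel. exp (- s) * s powr (real n - 1) * ln s ^ k) / fact k)"
  shows "summable (\<lambda>k. norm (a k *\<^sub>R mat_power M k))"
    and "(\<lambda>k. a k *\<^sub>R mat_power M k) sums mat_Gamma (M + mat (of_nat n))"
proof -
  note series = Gamma_moment_series[OF L]
  have "(\<Sum>k. (ln s ^ k / fact k) *\<^sub>R mat_power M k) = mat_powr s M" for s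
    by (simp add: mat_powr_def mat_exp_def mat_power_scaleR mult.commute)
  moreover have "s powr (real n - 1) *\<^sub>R mat_powr s M = mat_powr s (M + mat (of_nat n) - mat 1)"
    if "s > 0" for s
    using that
    by (simp add: mat_powr_diff_mat_1 mat_powr_add_of_nat powr_diff powr_realpow)
  ultimately have "(LINT s:{0<..}|lborel. (exp (- s) * s powr (real n - 1)) *\<^sub>R
      (\<Sum>k. (ln s ^ k / fact k) *\<^sub>R mat_power M k)) = mat_Gamma (M + mat (of_nat n))"
    unfolding mat_Gamma_def
    by (intro set_lebesgue_integral_cong) (auto simp flip: scaleR_scaleR)
  with series show "summable (\<lambda>k. norm (a k *\<^sub>R mat_power M k))"
    "(\<lambda>k. a k *\<^sub>R mat_power M k) sums mat_Gamma (M + mat (of_nat n))" by (simp_all add: a_def)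
qed

section \<open>Entire functions of a matrix, Cauchy products and uniqueness of coefficients\<close>

lemma entire_power_series:
  assumes "f holomorphic_on UNIV"
  shows "(\<lambda>n. (deriv ^^ n) f 0 / fact n * z ^ n) sums f z"
    and "summable (\<lambda>n. norm ((deriv ^^ n) f 0 / fact n * z ^ n))"
proof -
  have *: "(\<lambda>n. (deriv ^^ n) f 0 / fact n * z ^ n) sums f z" for z
    using holomorphic_power_series[of f 0 "norm z + 1" z] assms
    by (auto intro: holomorphic_on_subset)
  show "(\<lambda>n. (deriv ^^ n) f 0 / fact n * z ^ n) sums f z" by (rule *)
  show "summable (\<lambda>n. norm ((deriv ^^ n) f 0 / fact n * z ^ n))"
    using powser_insidea[of "\<lambda>n. (deriv ^^ n) f 0 / fact n" "of_real (norm z + 1)" z]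
      *[of "of_real (norm z + 1)"]
    by (simp add: sums_iff del: of_real_add)
qed

lemma mat_entire_sums:
  fixes M :: "complex^'r^'r"
  assumes "f holomorphic_on UNIV"
  shows "summable (\<lambda>n. norm (mat ((deriv ^^ n) f 0 / fact n) ** mat_power M n))"
    and "(\<lambda>n. mat ((deriv ^^ n) f 0 / fact n) ** mat_power M n) sums mat_entire f M"
proof -
  obtain L where L: "L > 0" "\<And>n. norm (mat_power M n) \<le> norm (mat 1 :: complex^'r^'r) * L ^ n"
    using mat_power_bound[of M] by blast
  show *: "summable (\<lambda>n. norm (mat ((deriv ^^ n) f 0 / fact n) ** mat_power M n))"
  proof (rule summable_comparison_test')
    show "summable (\<lambda>n. norm (mat 1 :: complex^'r^'r) * norm ((deriv ^^ n) f 0 / fact n * of_real L ^ n))"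
      by (intro summable_mult entire_power_series assms)
    have "norm ((deriv ^^ n) f 0 / fact n) * norm (mat_power M n) \<le>
        norm ((deriv ^^ n) f 0 / fact n) * (norm (mat 1 :: complex^'r^'r) * L ^ n)" for n
      by (intro mult_left_mono L) simp
    thus "norm (norm (mat ((deriv ^^ n) f 0 / fact n) ** mat_power M n)) \<le>
        norm (mat 1 :: complex^'r^'r) * norm ((deriv ^^ n) f 0 / fact n * of_real L ^ n)" for n
      using L(1) unfolding norm_mat_mult by (simp add: norm_mult norm_divide norm_power mult_ac)
  qed
  show "(\<lambda>n. mat ((deriv ^^ n) f 0 / fact n) ** mat_power M n) sums mat_entire f M"
    unfolding mat_entire_def by (rule summable_sums[OF summable_norm_cancel[OF *]])
qed

text \<open>Each entry of x ** y is a finite sum of products of complex entries, and the entries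
  inherit absolute convergence from the norm; the complex Cauchy product theorem then applies to
  every summand.\<close>

lemma matrix_Cauchy_product_sums:
  fixes X Y :: "nat \<Rightarrow> complex^'r^'r"
  assumes "summable (\<lambda>k. norm (X k))" "X sums x" "summable (\<lambda>k. norm (Y k))" "Y sums y"
  shows "(\<lambda>n. \<Sum>i\<le>n. X i ** Y (n - i)) sums (x ** y)"
proof -
  have entry: "norm (Z $ i $ j) \<le> norm Z" for Z :: "complex^'r^'r" and i j
    by (rule order_trans[OF Finite_Cartesian_Product.norm_nth_le Finite_Cartesian_Product.norm_nth_le])
  have "(\<lambda>n. \<Sum>m\<le>n. X m $ i $ k * Y (n - m) $ k $ j) sums (x $ i $ k * y $ k $ j)" for i j k
  proof -
    have "summable (\<lambda>n. norm (X n $ i $ k))" "summable (\<lambda>n. norm (Y n $ k $ j))"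
      by (rule summable_comparison_test'[OF assms(1), of 0], simp add: entry)
         (rule summable_comparison_test'[OF assms(3), of 0], simp add: entry)
    from Cauchy_product_sums[OF this] show ?thesis
      using sums_unique[OF sums_matrix_entry[OF assms(2)]] sums_unique[OF sums_matrix_entry[OF assms(4)]]
      by simp
  qed
  hence "(\<lambda>n. \<Sum>k\<in>UNIV. \<Sum>m\<le>n. X m $ i $ k * Y (n - m) $ k $ j) sums
      (\<Sum>k\<in>UNIV. x $ i $ k * y $ k $ j)" for i j
    by (rule sums_sum)
  hence *: "(\<lambda>n. (\<Sum>m\<le>n. X m ** Y (n - m)) $ i $ j) sums ((x ** y) $ i $ j)" for i j
    by (simp add: matrix_matrix_mult_def sum.swap[of _ "{.._}"])
  show ?thesis
    unfolding sums_def
    by (rule vec_tendstoI, rule vec_tendstoI) (use * in \<open>simp add: sums_def\<close>)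
qed

text \<open>A nonzero coefficient of positive index would force the sum to be nonzero on a punctured
  disc. The constant coefficient is read off at z = 0.\<close>

lemma power_series_eq_0:
  fixes d :: "nat \<Rightarrow> complex"
  assumes "r > 0" "\<And>z. norm z < r \<Longrightarrow> (\<lambda>n. d n * z ^ n) sums 0"
  shows "d n = 0"
proof (cases "n = 0")
  case True
  thus ?thesis using assms(2)[of 0] assms(1) powser_sums_zero_iff[of d 0] by simp
next
  case False
  show ?thesis
  proof (rule ccontr)
    assume "d n \<noteq> 0"
    show False
    proof (rule powser_0_nonzero[of r 0 d "\<lambda>_. 0" n])
      fix s :: real
      assume "s > 0" and nz: "\<And>z :: complex. z \<in> cball 0 s - {0} \<Longrightarrow> (0 :: complex) \<noteq> 0"
      from nz[of "of_real s"] \<open>s > 0\<close> show False by simp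
    qed (use assms False \<open>d n \<noteq> 0\<close> in simp_all)
  qed
qed

lemma poly_pochhammer: "poly (pochhammer p n) z = pochhammer (poly p z) n"
  for z :: "'a::comm_ring_1"
  by (induction n) (simp_all add: pochhammer_Suc)

text \<open>Turns (M)_n into a polynomial in M, so that it can be compared with the product of power
  series coefficient by coefficient.\<close>

lemma poly_mat_pochhammer: "poly_mat (pochhammer [:0, 1:] n) M = mat_pochhammer M n"
proof (induction n)
  case (Suc n)
  have "[:0, 1:] + of_nat n = [:of_nat n, 1 :: complex:]" by (simp add: of_nat_poly)
  thus ?case
    using Suc by (simp add: pochhammer_Suc poly_mat_mult_linear del: mult_pCons_right)
qed (use poly_mat_const[of 1] in \<open>simp add: one_pCons\<close>)

text \<open>For \<open>n\<close> large, \<open>\<Gamma>(M + nI)\<close> is a norm convergent power series in \<open>M\<close>, so the scalar identity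
  \<open>\<Gamma>(n + z) / \<Gamma>(z) = (z)\<^sub>n\<close> carries over to \<open>M\<close> by multiplication of power series.\<close>

lemma mat_rGamma_mult_mat_Gamma_add_of_nat:
  fixes M :: "complex^'r^'r"
  obtains n where "mat_rGamma M ** mat_Gamma (M + mat (of_nat n)) = mat_pochhammer M n"
proof -
  obtain L where L: "L > 0" "\<And>n. norm (mat_power M n) \<le> norm (mat 1 :: complex^'r^'r) * L ^ n"
    using mat_power_bound[of M] by blast
  obtain n where n: "L < real n" using reals_Archimedean2 by blast
  define a where "a k = (LINT s:{0<..}|lborel. exp (- s) * s powr (real n - 1) * ln s ^ k) / fact k" for k
  define b where "b k = (deriv ^^ k) rGamma (0 :: complex) / fact k" for k
  \<comment> \<open>These are the Cauchy product coefficients of 1/\<Gamma>(z) and \<Gamma>(n + z).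
    They are scalars, so determining them for small complex z also determines the product of the
    matrix series.\<close>
  define c where "c N = (\<Sum>i\<le>N. b i * of_real (a (N - i)))" for N
  define P where "P = (pochhammer [:0, 1:] n :: complex poly)"
  have entire: "rGamma holomorphic_on UNIV" by (rule holomorphic_rGamma)
  have "c N - coeff P N = 0" for N
  proof (rule power_series_eq_0[OF L(1)])
    fix z :: complex assume z: "norm z < L"
    hence zn: "norm z < real n" using n by simp
    have "(\<lambda>N. \<Sum>i\<le>N. b i * z ^ i * (of_real (a (N - i)) * z ^ (N - i))) sums
        (rGamma z * Gamma (of_real (real n) + z))"
      using Cauchy_product_sums[OF entire_power_series(2)[OF entire] Gamma_moment_series_complex(1)[OF zn]]
        sums_unique[OF entire_power_series(1)[OF entire, of z]]
        sums_unique[OF Gamma_moment_series_complex(2)[OF zn]]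
      by (simp add: a_def b_def)
    also have "(\<lambda>N. \<Sum>i\<le>N. b i * z ^ i * (of_real (a (N - i)) * z ^ (N - i))) = (\<lambda>N. c N * z ^ N)"
    proof
      fix N
      have "b i * z ^ i * (of_real (a (N - i)) * z ^ (N - i)) = b i * of_real (a (N - i)) * z ^ N"
        if "i \<le> N" for i
      proof -
        have "z ^ N = z ^ i * z ^ (N - i)" using that by (simp flip: power_add)
        thus ?thesis by simp
      qed
      thus "(\<Sum>i\<le>N. b i * z ^ i * (of_real (a (N - i)) * z ^ (N - i))) = c N * z ^ N"
        unfolding c_def sum_distrib_right by (intro sum.cong refl) simp
    qed
    also have "rGamma z * Gamma (of_real (real n) + z) = pochhammer z n"
    proof -
      \<comment> \<open>From |z| < n the point z + n lies in the right half plane, away from the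
        poles of \<Gamma>, so \<Gamma>(z + n) and its reciprocal cancel.\<close>
      have pos: "Re (z + of_nat n) > 0" using zn abs_Re_le_cmod[of z] by simp
      have "z + of_nat n \<notin> \<int>\<^sub>\<le>\<^sub>0"
      proof
        assume "z + of_nat n \<in> \<int>\<^sub>\<le>\<^sub>0"
        then obtain k where "z + of_nat n = - of_nat k" by (elim nonpos_Ints_cases')
        hence "Re (z + of_nat n) = - real k" by (simp only: uminus_complex.sel complex_Re_of_nat)
        with pos show False by simp
      qed
      hence "rGamma (z + of_nat n) * Gamma (z + of_nat n) = 1"
        by (simp add: rGamma_inverse_Gamma Gamma_eq_zero_iff)
      thus ?thesis by (simp add: pochhammer_rGamma[of z n] mult.assoc add.commute)
    qed
    also have "\<dots> = poly P z" by (simp add: P_def poly_pochhammer)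
    finally have "(\<lambda>N. c N * z ^ N) sums poly P z" .
    moreover have "(\<lambda>N. coeff P N * z ^ N) sums poly P z"
      unfolding poly_altdef by (rule sums_finite) (auto simp: coeff_eq_0)
    ultimately show "(\<lambda>N. (c N - coeff P N) * z ^ N) sums 0"
      using sums_diff[of "\<lambda>N. c N * z ^ N" "poly P z" "\<lambda>N. coeff P N * z ^ N" "poly P z"]
      by (simp add: left_diff_distrib)
  qed
  hence c: "c N = coeff P N" for N by simp
  have "(\<lambda>N. \<Sum>i\<le>N. (mat (b i) ** mat_power M i) ** (a (N - i) *\<^sub>R mat_power M (N - i))) sums
      (mat_rGamma M ** mat_Gamma (M + mat (of_nat n)))"
    unfolding mat_rGamma_def b_def a_def
    by (intro matrix_Cauchy_product_sums mat_entire_sums[OF entire] Gamma_moment_series_matrix[OF L(1) n L(2)])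
  also have "(\<lambda>N. \<Sum>i\<le>N. (mat (b i) ** mat_power M i) ** (a (N - i) *\<^sub>R mat_power M (N - i))) =
      (\<lambda>N. mat (coeff P N) ** mat_power M N)"
  proof
    fix N
    have "(mat (b i) ** mat_power M i) ** (a (N - i) *\<^sub>R mat_power M (N - i)) =
        mat (b i * of_real (a (N - i))) ** mat_power M N" if "i \<le> N" for i
    proof -
      have "mat_power M N = mat_power M i ** mat_power M (N - i)"
        using that by (simp flip: mat_power_add)
      thus ?thesis
        unfolding matmul.scaleR_right
        by (simp add: scaleR_conv_mat[of "a _"] matrix_mul_assoc mat_mult_mat mult.commute)
    qed
    moreover have "mat (sum f A) = (\<Sum>i\<in>A. mat (f i) :: complex^'r^'r)" if "finite A" for f :: "nat \<Rightarrow> complex" and A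
      using that by induction (simp_all add: mat_add)
    ultimately show "(\<Sum>i\<le>N. (mat (b i) ** mat_power M i) ** (a (N - i) *\<^sub>R mat_power M (N - i))) =
        mat (coeff P N) ** mat_power M N"
      by (simp add: c_def matmul.sum_left flip: c)
  qed
  finally have "(\<lambda>N. mat (coeff P N) ** mat_power M N) sums
      (mat_rGamma M ** mat_Gamma (M + mat (of_nat n)))" .
  moreover have "(\<lambda>N. mat (coeff P N) ** mat_power M N) sums poly_mat P M"
    unfolding poly_mat_def by (rule sums_finite) (auto simp: coeff_eq_0 matmul.zero_left)
  ultimately have "mat_rGamma M ** mat_Gamma (M + mat (of_nat n)) = mat_pochhammer M n"
    unfolding P_def poly_mat_pochhammer by (rule sums_unique2)
  thus ?thesis by (rule that)
qed

lemma mat_rGamma_commute: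
  assumes "X ** M = M ** X"
  shows "X ** mat_rGamma M = mat_rGamma M ** X"
proof -
  have "rGamma holomorphic_on (UNIV :: complex set)" by (rule holomorphic_rGamma)
  note sums = mat_entire_sums(2)[OF this, of M, folded mat_rGamma_def]
  have "X ** (mat c ** mat_power M n) = (mat c ** mat_power M n) ** X" for c n
    using mat_power_commute[OF assms, of n] by (metis mat_commute matrix_mul_assoc)
  with bounded_linear.sums[OF matmul.bounded_linear_right[of X] sums]
    bounded_linear.sums[OF matmul.bounded_linear_left[of X] sums]
  show ?thesis by (simp add: sums_unique2)
qed

lemma mat_Gamma_commute:
  assumes "positive_stable M" "X ** M = M ** X"
  shows "X ** mat_Gamma M = mat_Gamma M ** X"
proof -
  have "X ** (M - mat 1) = (M - mat 1) ** X"
    using assms(2) by (simp add: matmul.diff_left matmul.diff_right)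
  hence "X ** (exp (- s) *\<^sub>R mat_powr s (M - mat 1)) = (exp (- s) *\<^sub>R mat_powr s (M - mat 1)) ** X" for s
    by (simp add: matmul.scaleR_left matmul.scaleR_right mat_powr_commute)
  thus ?thesis
    using set_integrable_bounded_linear(2)[OF matmul.bounded_linear_right[of X] mat_Gamma_integrable[OF assms(1)]]
      set_integrable_bounded_linear(2)[OF matmul.bounded_linear_left[of X] mat_Gamma_integrable[OF assms(1)]]
    by (simp add: mat_Gamma_def)
qed

text \<open>Writing \<Gamma>(M + nI) = (M)_n \<Gamma>(M) and commuting (M)_n past
  \<Gamma>\<inverse>(M) turns the shifted identity into (M)_n \<Gamma>\<inverse>(M) \<Gamma>(M) =
  (M)_n. Stability makes (M)_n invertible, so it cancels.\<close>

lemma mat_rGamma_mult_mat_Gamma: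
  fixes M :: "complex^'r^'r"
  assumes "positive_stable M"
  shows "mat_rGamma M ** mat_Gamma M = mat 1"
proof -
  obtain n where n: "mat_rGamma M ** mat_Gamma (M + mat (of_nat n)) = mat_pochhammer M n"
    by (rule mat_rGamma_mult_mat_Gamma_add_of_nat)
  have "mat_pochhammer M n ** mat_rGamma M = mat_rGamma M ** mat_pochhammer M n"
    by (intro mat_rGamma_commute mat_pochhammer_commute[symmetric]) simp
  with n have "mat_pochhammer M n ** (mat_rGamma M ** mat_Gamma M) = mat_pochhammer M n"
    by (simp add: mat_Gamma_add_of_nat[OF assms] matrix_mul_assoc)
  moreover have "invertible (mat_pochhammer M n)"
    by (intro invertible_mat_pochhammer positive_stable_invertible positive_stable_add_of_nat assms)
  then obtain Q where "Q ** mat_pochhammer M n = mat 1" by (auto simp: invertible_def)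
  ultimately show ?thesis by (metis matrix_mul_assoc matrix_mul_lid)
qed

subsection \<open>The matrix beta integral\<close>

text \<open>Euler's form of the beta function, kept apart from \<open>mat_Beta\<close>, which is
  defined by gamma functions; it is the form whose moments are needed.\<close>

definition mat_Beta_integral :: "complex^'r^'r \<Rightarrow> complex^'r^'r \<Rightarrow> complex^'r^'r" where
  "mat_Beta_integral E G =
    (LINT t:{0<..<1}|lborel. mat_powr t (E - mat 1) ** mat_powr (1 - t) (G - mat 1))"

lemma mat_powr_bound_unit:
  fixes M :: "complex^'r^'r"
  assumes "positive_stable M"
  obtains C \<delta> where "\<delta> > 0" "C \<ge> 0"
    "\<And>s. 0 < s \<Longrightarrow> s < 1 \<Longrightarrow> norm (mat_powr s (M - mat 1)) \<le> C * s powr (\<delta> - 1)"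
proof -
  obtain C \<delta> L where C: "\<delta> > 0" "C \<ge> 0" "L \<ge> \<delta>"
    "\<And>s. s > 0 \<Longrightarrow> norm (mat_powr s (M - mat 1)) \<le> C * (s powr (\<delta> - 1) + s powr (L - 1))"
    using mat_powr_bound[OF assms] by metis
  have "norm (mat_powr s (M - mat 1)) \<le> (2 * C) * s powr (\<delta> - 1)" if s: "0 < s" "s < 1" for s
  proof -
    have "s powr (L - 1) \<le> s powr (\<delta> - 1)" using s C(3) by (intro powr_mono') auto
    hence "C * (s powr (\<delta> - 1) + s powr (L - 1)) \<le> C * (s powr (\<delta> - 1) + s powr (\<delta> - 1))"
      using C(2) by (intro mult_left_mono) auto
    with C(4)[OF s(1)] show ?thesis by simp
  qed
  with C(1,2) show ?thesis by (intro that[of \<delta> "2 * C"]) auto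
qed

lemma mat_Beta_integrable:
  fixes E G :: "complex^'r^'r"
  assumes "positive_stable E" "positive_stable G"
  shows "set_integrable lborel {0<..<1} (\<lambda>t. mat_powr t (E - mat 1) ** mat_powr (1 - t) (G - mat 1))"
proof -
  obtain C \<delta> where C: "\<delta> > 0" "C \<ge> 0"
    "\<And>s. 0 < s \<Longrightarrow> s < 1 \<Longrightarrow> norm (mat_powr s (E - mat 1)) \<le> C * s powr (\<delta> - 1)"
    using mat_powr_bound_unit[OF assms(1)] by metis
  obtain D \<epsilon> where D: "\<epsilon> > 0" "D \<ge> 0"
    "\<And>s. 0 < s \<Longrightarrow> s < 1 \<Longrightarrow> norm (mat_powr s (G - mat 1)) \<le> D * s powr (\<epsilon> - 1)"
    using mat_powr_bound_unit[OF assms(2)] by metis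
  obtain K where K: "K > 0" "\<And>(X :: complex^'r^'r) (Y :: complex^'r^'r). norm (X ** Y) \<le> norm X * norm Y * K"
    using matmul.pos_bounded by blast
  have "set_integrable lborel {0<..<1} (\<lambda>t. t powr (\<delta> - 1) * (1 - t) powr (\<epsilon> - 1))"
    by (rule set_integrable_subset[OF integrable_Beta[OF C(1) D(1)]]) auto
  hence "set_integrable lborel {0<..<1} (\<lambda>t. (C * D * K) * (t powr (\<delta> - 1) * (1 - t) powr (\<epsilon> - 1)))"
    by (intro set_integrable_mult_right)
  thus ?thesis
  proof (rule set_integrable_bound)
    show "set_borel_measurable lborel {0<..<1} (\<lambda>t. mat_powr t (E - mat 1) ** mat_powr (1 - t) (G - mat 1))"
      unfolding set_borel_measurable_def by measurable
    have "norm (mat_powr t (E - mat 1) ** mat_powr (1 - t) (G - mat 1)) \<le>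
        (C * D * K) * (t powr (\<delta> - 1) * (1 - t) powr (\<epsilon> - 1))" if t: "0 < t" "t < 1" for t
    proof -
      have "norm (mat_powr t (E - mat 1) ** mat_powr (1 - t) (G - mat 1)) \<le>
          norm (mat_powr t (E - mat 1)) * norm (mat_powr (1 - t) (G - mat 1)) * K" by (rule K(2))
      also have "\<dots> \<le> (C * t powr (\<delta> - 1)) * (D * (1 - t) powr (\<epsilon> - 1)) * K"
        using K(1) C(2) D(2) t by (intro mult_right_mono mult_mono C(3) D(3)) auto
      finally show ?thesis by (simp add: mult_ac)
    qed
    thus "AE t in lborel. t \<in> {0<..<1} \<longrightarrow>
        norm (mat_powr t (E - mat 1) ** mat_powr (1 - t) (G - mat 1)) \<le>
        norm ((C * D * K) * (t powr (\<delta> - 1) * (1 - t) powr (\<epsilon> - 1)))"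
      by (intro AE_I2 impI) (fastforce intro: order_trans[OF _ abs_ge_self])
  qed
qed

text \<open>Fubini for \<open>e\<^sup>-\<^sup>w s\<^sup>E\<^sup>-\<^sup>I (w - s)\<^sup>G\<^sup>-\<^sup>I\<close> on \<open>0 < s < w\<close>: the \<open>w\<close>-integral is evaluated by the shift
  \<open>w = s + u\<close>, the \<open>s\<close>-integral by the scaling \<open>s = w t\<close>.\<close>

theorem mat_Gamma_mult_mat_Gamma:
  fixes E G :: "complex^'r^'r"
  assumes E: "positive_stable E" and G: "positive_stable G" and EG: "positive_stable (E + G)"
    and comm: "E ** G = G ** E"
  shows "mat_Gamma E ** mat_Gamma G = mat_Gamma (E + G) ** mat_Beta_integral E G"
proof -
  \<comment> \<open>The indicators are built into the factors, so that all integrals run over the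
    whole line and \<open>p s ** q (w - s)\<close> vanishes by itself outside 0 < s < w.\<close>
  define P where "P s = indicator {0<..} s *\<^sub>R mat_powr s (E - mat 1)" for s :: real
  define Q where "Q s = indicator {0<..} s *\<^sub>R mat_powr s (G - mat 1)" for s :: real
  define p where "p s = exp (- s) *\<^sub>R P s" for s
  define q where "q s = exp (- s) *\<^sub>R Q s" for s
  have [measurable]: "P \<in> borel_measurable borel" "Q \<in> borel_measurable borel"
    unfolding P_def Q_def by measurable
  have [measurable]: "p \<in> borel_measurable borel" "q \<in> borel_measurable borel"
    unfolding p_def q_def by measurable
  have p: "integrable lborel p" "integral\<^sup>L lborel p = mat_Gamma E"
    using mat_Gamma_integrable[OF E]
    by (simp_all add: p_def[abs_def] P_def set_integrable_def mat_Gamma_def set_lebesgue_integral_def mult.commute)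
  have q: "integrable lborel q" "integral\<^sup>L lborel q = mat_Gamma G"
    using mat_Gamma_integrable[OF G]
    by (simp_all add: q_def[abs_def] Q_def set_integrable_def mat_Gamma_def set_lebesgue_integral_def mult.commute)
  obtain K where K: "K > 0" "\<And>(X :: complex^'r^'r) (Y :: complex^'r^'r). norm (X ** Y) \<le> norm X * norm Y * K"
    using matmul.pos_bounded by blast
  define H where "H = (\<lambda>(s, w). p s ** q (w - s))"
  have [measurable]: "H \<in> borel_measurable (lborel \<Otimes>\<^sub>M lborel)"
    unfolding H_def by measurable
  have pq: "integrable lborel (\<lambda>u. p s ** q u)" "(\<integral>u. p s ** q u \<partial>lborel) = p s ** mat_Gamma G" for s
    using q integrable_bounded_linear[OF matmul.bounded_linear_right q(1)]
      integral_bounded_linear[OF matmul.bounded_linear_right q(1)] by simp_all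
  have H1: "integrable lborel (\<lambda>w. H (s, w))" for s
    using lborel_integrable_real_affine[OF pq(1)[of s], of 1 "- s"] by (simp add: H_def)
  have shift: "(\<integral>w. f (w - s) \<partial>lborel) = (\<integral>u. f u \<partial>lborel)"
    for f :: "real \<Rightarrow> 'b::{banach, second_countable_topology}" and s :: real
    using lborel_integral_real_affine[of 1 f "- s"] by simp
  have H2: "(\<integral>w. H (s, w) \<partial>lborel) = p s ** mat_Gamma G" for s
    using shift[of "\<lambda>u. p s ** q u" s] pq(2)[of s] by (simp add: H_def)
  have "integrable (lborel \<Otimes>\<^sub>M lborel) H"
  proof (rule lborel_pair.Fubini_integrable)
    show "AE s in lborel. integrable lborel (\<lambda>w. H (s, w))" using H1 by simp
    \<comment> \<open>After the shift w = s + u, the inner integral of norms is at most norm (p s)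
      times a constant independent of s.\<close>
    have "integrable lborel (\<lambda>s. norm (p s) * (K * (\<integral>u. norm (q u) \<partial>lborel)))"
      using p(1) by (intro integrable_mult_left integrable_norm)
    thus "integrable lborel (\<lambda>s. \<integral>w. norm (H (s, w)) \<partial>lborel)"
    proof (rule Bochner_Integration.integrable_bound)
      show "(\<lambda>s. \<integral>w. norm (H (s, w)) \<partial>lborel) \<in> borel_measurable lborel" by measurable
      have "norm (\<integral>w. norm (H (s, w)) \<partial>lborel) \<le> norm (norm (p s) * (K * (\<integral>u. norm (q u) \<partial>lborel)))" for s
      proof -
        have "(\<integral>w. norm (H (s, w)) \<partial>lborel) = (\<integral>u. norm (p s ** q u) \<partial>lborel)"
          using shift[of "\<lambda>u. norm (p s ** q u)" s] by (simp add: H_def)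
        also have "\<dots> \<le> (\<integral>u. norm (p s) * K * norm (q u) \<partial>lborel)"
        proof (intro integral_mono integrable_norm integrable_mult_right pq(1) q(1))
          show "norm (p s ** q u) \<le> norm (p s) * K * norm (q u)" for u
            using K(2)[of "p s" "q u"] by (simp add: mult_ac)
        qed
        also have "\<dots> = norm (p s) * (K * (\<integral>u. norm (q u) \<partial>lborel))"
          by (simp add: mult_ac)
        finally show ?thesis
          by (simp add: integral_nonneg_AE abs_of_nonneg)
      qed
      thus "AE s in lborel. norm (\<integral>w. norm (H (s, w)) \<partial>lborel) \<le>
          norm (norm (p s) * (K * (\<integral>u. norm (q u) \<partial>lborel)))" by simp
    qed
  qed measurable
  hence "(\<integral>w. (\<integral>s. H (s, w) \<partial>lborel) \<partial>lborel) = (\<integral>s. (\<integral>w. H (s, w) \<partial>lborel) \<partial>lborel)"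
    using lborel_pair.Fubini_integral[of "\<lambda>s w. H (s, w)"] by (simp add: case_prod_eta)
  also have "\<dots> = mat_Gamma E ** mat_Gamma G"
    using integral_bounded_linear[OF matmul.bounded_linear_left p(1)] by (simp add: H2 p(2))
  finally have 1: "mat_Gamma E ** mat_Gamma G = (\<integral>w. (\<integral>s. H (s, w) \<partial>lborel) \<partial>lborel)" by simp
  define b where "b t = mat_powr t (E - mat 1) ** mat_powr (1 - t) (G - mat 1)" for t
  have b: "set_integrable lborel {0<..<1} b" unfolding b_def by (rule mat_Beta_integrable[OF E G])
  have comm1: "(E - mat 1) ** (G - mat 1) = (G - mat 1) ** (E - mat 1)"
    using comm by (simp add: matmul.diff_left matmul.diff_right)
  have H3: "(\<integral>s. H (s, w) \<partial>lborel) =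
      (indicator {0<..} w *\<^sub>R exp (- w) *\<^sub>R mat_powr w (E + G - mat 1)) ** mat_Beta_integral E G" for w
  proof (cases "w > 0")
    case False
    hence "H (s, w) = 0" for s
      by (simp add: H_def p_def q_def P_def Q_def indicator_def matmul.zero_left matmul.zero_right)
    thus ?thesis using False by (simp add: matmul.zero_left)
  next
    case True
    \<comment> \<open>The factor 1 / w arises from w^(E-I) w^(G-I) = w^(E+G-2I); it cancels the
      Jacobian w of the scaling s = w t.\<close>
    define Z where "Z = exp (- w) *\<^sub>R ((1 / w) *\<^sub>R mat_powr w (E + G - mat 1))"
    have "w *\<^sub>R H (w * t, w) = indicator {0<..<1} t *\<^sub>R ((w *\<^sub>R Z) ** b t)" for t
    proof (cases "t \<in> {0<..<1}")
      case False
      hence "w * t \<le> 0 \<or> w - w * t \<le> 0" using True by (auto simp: mult_le_0_iff not_less)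
      thus ?thesis using False
        by (auto simp: H_def p_def q_def P_def Q_def matmul.zero_left matmul.zero_right)
    next
      case t: True
      have "w * t > 0" "1 - t > 0" "w - w * t = w * (1 - t)" "w * (1 - t) > 0"
        using t \<open>w > 0\<close> by (auto simp: algebra_simps)
      hence "H (w * t, w) = exp (- w) *\<^sub>R
          (mat_powr w (E - mat 1) ** mat_powr t (E - mat 1) ** (mat_powr w (G - mat 1) ** mat_powr (1 - t) (G - mat 1)))"
        using t \<open>w > 0\<close>
        by (simp add: H_def p_def q_def P_def Q_def matmul.scaleR_left matmul.scaleR_right mat_powr_mult
            flip: exp_add)
      also have "mat_powr w (E - mat 1) ** mat_powr t (E - mat 1) ** (mat_powr w (G - mat 1) ** mat_powr (1 - t) (G - mat 1))
          = mat_powr w (E - mat 1) ** mat_powr w (G - mat 1) ** b t"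
      proof -
        have "mat_powr w (G - mat 1) ** (E - mat 1) = (E - mat 1) ** mat_powr w (G - mat 1)"
          using mat_powr_commute[OF comm1] by simp
        hence "mat_powr w (G - mat 1) ** mat_powr t (E - mat 1) = mat_powr t (E - mat 1) ** mat_powr w (G - mat 1)"
          by (rule mat_powr_commute)
        thus ?thesis unfolding b_def by (metis matrix_mul_assoc)
      qed
      also have "mat_powr w (E - mat 1) ** mat_powr w (G - mat 1) = mat_powr w (E + G - mat 1 - mat 1)"
        by (simp add: algebra_simps flip: mat_powr_add[OF comm1])
      also have "\<dots> = (1 / w) *\<^sub>R mat_powr w (E + G - mat 1)"
        using \<open>w > 0\<close> by (rule mat_powr_diff_mat_1)
      finally show ?thesis using t by (simp add: Z_def matmul.scaleR_left)
    qed
    hence "(\<integral>s. H (s, w) \<partial>lborel) = (LINT t:{0<..<1}|lborel. (w *\<^sub>R Z) ** b t)"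
      using lborel_integral_real_affine[of w "\<lambda>s. H (s, w)" 0] True
      by (simp add: set_lebesgue_integral_def flip: integral_scaleR_right)
    also have "\<dots> = (w *\<^sub>R Z) ** mat_Beta_integral E G"
      using set_integrable_bounded_linear(2)[OF matmul.bounded_linear_right b]
      by (simp add: b_def mat_Beta_integral_def)
    finally show ?thesis using True by (simp add: Z_def)
  qed
  show ?thesis
    unfolding 1 H3
    using integral_bounded_linear[OF matmul.bounded_linear_left mat_Gamma_integrable[OF EG, unfolded set_integrable_def],
        of "mat_Beta_integral E G"]
    by (simp add: mat_Gamma_def set_lebesgue_integral_def)
qed

section \<open>Matrix inverses and the moments of the beta kernel\<close>

lemma matrix_inv_mult:
  assumes "invertible A"
  shows "A ** matrix_inv A = mat 1" "matrix_inv A ** A = mat 1"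
  using someI_ex[OF assms[unfolded invertible_def]] unfolding matrix_inv_def by simp_all

lemma matrix_inv_commute:
  assumes "invertible A" "X ** A = A ** X"
  shows "X ** matrix_inv A = matrix_inv A ** X"
proof -
  have "matrix_inv A ** (X ** A) ** matrix_inv A = matrix_inv A ** (A ** X) ** matrix_inv A"
    by (simp add: assms)
  hence "matrix_inv A ** X ** (A ** matrix_inv A) = (matrix_inv A ** A) ** X ** matrix_inv A"
    by (simp add: matrix_mul_assoc)
  thus ?thesis using matrix_inv_mult[OF assms(1)] by simp
qed

lemma mat_Gamma_mult_mat_rGamma:
  fixes M :: "complex^'r^'r"
  assumes "positive_stable M"
  shows "mat_Gamma M ** mat_rGamma M = mat 1"
  using mat_rGamma_mult_mat_Gamma[OF assms] matrix_left_right_inverse by blast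

lemma invertible_mat_Beta:
  assumes "positive_stable E" "positive_stable G" "positive_stable (E + G)"
  shows "invertible (mat_Beta E G)"
  unfolding mat_Beta_def
  using mat_rGamma_mult_mat_Gamma mat_Gamma_mult_mat_rGamma assms
  by (intro invertible_mult) (auto simp: invertible_def)

lemma mat_rGamma_add_of_nat:
  fixes M :: "complex^'r^'r"
  assumes "positive_stable M"
  shows "mat_rGamma (M + mat (of_nat m)) = mat_rGamma M ** matrix_inv (mat_pochhammer M m)"
proof -
  let ?W = "mat_pochhammer M m"
  have inv: "invertible ?W"
    by (intro invertible_mat_pochhammer positive_stable_invertible positive_stable_add_of_nat assms)
  have "mat_rGamma (M + mat (of_nat m)) ** ?W ** mat_Gamma M = mat 1"
    using mat_rGamma_mult_mat_Gamma[OF positive_stable_add_of_nat[OF assms, of m]]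
    by (simp add: mat_Gamma_add_of_nat[OF assms] matrix_mul_assoc)
  hence "mat_rGamma (M + mat (of_nat m)) ** ?W = mat_rGamma M"
    using mat_Gamma_mult_mat_rGamma[OF assms] by (metis matrix_mul_assoc matrix_mul_lid matrix_mul_rid)
  thus ?thesis using matrix_inv_mult[OF inv] by (metis matrix_mul_assoc matrix_mul_rid)
qed

text \<open>The power t^m is absorbed into t^(E-I), so the moment is the beta integral at E + mI and
  G. The shift rules for \<Gamma> and \<Gamma>\<inverse> then split off (E)_m and the inverse of (E
  + G)_m.\<close>

lemma mat_Beta_moment:
  fixes E G :: "complex^'r^'r"
  assumes E: "positive_stable E" and G: "positive_stable G" and F: "positive_stable (E + G)"
    and comm: "E ** G = G ** E"
  shows "(LINT t:{0<..<1}|lborel. t ^ m *\<^sub>R (mat_powr t (E - mat 1) ** mat_powr (1 - t) (G - mat 1))) =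
    mat_pochhammer E m ** matrix_inv (mat_pochhammer (E + G) m) ** mat_Beta E G"
proof -
  define W where "W = mat_pochhammer (E + G) m"
  define R where "R = mat_rGamma (E + G)"
  have W: "invertible W" unfolding W_def
    by (intro invertible_mat_pochhammer positive_stable_invertible positive_stable_add_of_nat F)
  let ?Em = "E + mat (of_nat m)"
  have Em: "positive_stable ?Em" "positive_stable (?Em + G)"
    using positive_stable_add_of_nat[OF E, of m] positive_stable_add_of_nat[OF F, of m] by (simp_all add: ac_simps)
  have "mat_powr t (E + mat (of_nat m) - mat 1) = t ^ m *\<^sub>R mat_powr t (E - mat 1)" if "t > 0" for t
    using mat_powr_add_of_nat[OF that, of "E - mat 1" m] by (simp add: algebra_simps)
  hence "(LINT t:{0<..<1}|lborel. t ^ m *\<^sub>R (mat_powr t (E - mat 1) ** mat_powr (1 - t) (G - mat 1))) =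
      mat_Beta_integral ?Em G"
    unfolding mat_Beta_integral_def by (intro set_lebesgue_integral_cong) (auto simp: matmul.scaleR_left)
  also have "\<dots> = mat_rGamma (?Em + G) ** (mat_Gamma ?Em ** mat_Gamma G)"
  proof -
    have "?Em ** G = G ** ?Em" using comm by (simp add: matmul.add_left matmul.add_right mat_commute)
    from mat_Gamma_mult_mat_Gamma[OF Em(1) G Em(2) this] show ?thesis
      using mat_rGamma_mult_mat_Gamma[OF Em(2)] by (simp add: matrix_mul_assoc)
  qed
  also have "mat_rGamma (?Em + G) = R ** matrix_inv W"
    using mat_rGamma_add_of_nat[OF F, of m] by (simp add: R_def W_def ac_simps)
  also have "mat_Gamma ?Em = mat_pochhammer E m ** mat_Gamma E" by (rule mat_Gamma_add_of_nat[OF E])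
  also have "R ** matrix_inv W ** (mat_pochhammer E m ** mat_Gamma E ** mat_Gamma G) =
      mat_pochhammer E m ** matrix_inv W ** (mat_Gamma E ** mat_Gamma G ** R)"
  proof -
    \<comment> \<open>E and G commute with E + G, hence with R = \<Gamma>\<inverse>(E + G); the
      swaps derived from this carry R to the right end, where \<open>mat_Beta\<close> has
      it.\<close>
    have EF: "E ** (E + G) = (E + G) ** E" "G ** (E + G) = (E + G) ** G"
      using comm by (simp_all add: matmul.add_left matmul.add_right)
    have RE: "E ** R = R ** E" "G ** R = R ** G" and "(E + G) ** R = R ** (E + G)"
      unfolding R_def by (intro mat_rGamma_commute EF refl)+
    hence RW: "R ** matrix_inv W = matrix_inv W ** R"
      unfolding W_def by (intro matrix_inv_commute W[unfolded W_def] mat_pochhammer_commute) simp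
    have RP: "R ** mat_pochhammer E m = mat_pochhammer E m ** R"
      using RE(1) by (intro mat_pochhammer_commute) simp
    have RG: "R ** mat_Gamma E = mat_Gamma E ** R" "R ** mat_Gamma G = mat_Gamma G ** R"
      using RE E G by (auto intro!: mat_Gamma_commute)
    have "E ** W = W ** E" unfolding W_def by (intro mat_pochhammer_commute EF)
    hence WP: "matrix_inv W ** mat_pochhammer E m = mat_pochhammer E m ** matrix_inv W"
      by (intro mat_pochhammer_commute matrix_inv_commute[OF W, symmetric]) 
    have "R ** matrix_inv W ** (mat_pochhammer E m ** mat_Gamma E ** mat_Gamma G) =
        matrix_inv W ** mat_pochhammer E m ** (R ** mat_Gamma E ** mat_Gamma G)"
      by (simp only: RW) (metis RP matrix_mul_assoc)
    also have "R ** mat_Gamma E ** mat_Gamma G = mat_Gamma E ** mat_Gamma G ** R"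
      by (metis RG matrix_mul_assoc)
    finally show ?thesis by (simp only: WP)
  qed
  finally show ?thesis unfolding W_def mat_Beta_def R_def .
qed

subsection \<open>The integral representation\<close>

text \<open>On (0,1) the factor t^m is at most 1, so the m-th term is dominated by norm (S m) times
  a fixed integrable function, and absolute convergence at t = 1 suffices for exchanging sum and
  integral. The coefficients remain to the left of the kernel throughout.\<close>

lemma set_integral_matrix_power_series:
  fixes S :: "nat \<Rightarrow> complex^'r^'r" and K :: "real \<Rightarrow> complex^'r^'r"
  assumes S: "summable (\<lambda>m. norm (S m))" and K: "set_integrable lborel {0<..<1} K"
  shows "set_integrable lborel {0<..<1} (\<lambda>t. (\<Sum>m. t ^ m *\<^sub>R S m) ** K t)"
    and "(\<lambda>m. S m ** (LINT t:{0<..<1}|lborel. t ^ m *\<^sub>R K t)) sums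
      (LINT t:{0<..<1}|lborel. (\<Sum>m. t ^ m *\<^sub>R S m) ** K t)"
proof -
  obtain C where C: "C > 0" "\<And>(X :: complex^'r^'r) (Y :: complex^'r^'r). norm (X ** Y) \<le> norm X * norm Y * C"
    using matmul.pos_bounded by blast
  define k where "k t = indicator {0<..<1} t *\<^sub>R K t" for t :: real
  have k: "integrable lborel k" using K by (simp add: k_def[abs_def] set_integrable_def)
  hence [measurable]: "k \<in> borel_measurable borel" by (simp add: borel_measurable_integrable)
  have pow_le: "norm (t ^ m *\<^sub>R k t) \<le> norm (k t)" for m t
  proof (cases "t \<in> {0<..<1}")
    case True
    hence "\<bar>t ^ m\<bar> \<le> 1" by (simp add: power_le_one)
    thus ?thesis by (simp add: mult_left_le_one_le)
  qed (simp add: k_def)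
  have tk: "integrable lborel (\<lambda>t. t ^ m *\<^sub>R k t)" for m
    using k by (rule Bochner_Integration.integrable_bound) (use pow_le in auto)
  define f where "f m t = S m ** (t ^ m *\<^sub>R k t)" for m t
  have f_int: "integrable lborel (f m)" and f_val: "integral\<^sup>L lborel (f m) = S m ** (\<integral>t. t ^ m *\<^sub>R k t \<partial>lborel)" for m
    unfolding f_def
    using integrable_bounded_linear[OF matmul.bounded_linear_right tk]
      integral_bounded_linear[OF matmul.bounded_linear_right tk] by blast+
  have f_le: "norm (f m t) \<le> norm (S m) * (C * norm (k t))" for m t
  proof -
    have "norm (f m t) \<le> norm (S m) * norm (t ^ m *\<^sub>R k t) * C" unfolding f_def by (rule C(2))
    also have "\<dots> \<le> norm (S m) * norm (k t) * C"
      using C(1) pow_le by (intro mult_right_mono mult_left_mono) auto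
    finally show ?thesis by (simp add: mult_ac)
  qed
  have 1: "AE t in lborel. summable (\<lambda>m. norm (f m t))"
    by (intro AE_I2 summable_comparison_test'[OF summable_mult2[OF S], of 0]) (use f_le in auto)
  have 2: "summable (\<lambda>m. \<integral>t. norm (f m t) \<partial>lborel)"
  proof (rule summable_comparison_test'[OF summable_mult2[OF S], of 0])
    show "norm (\<integral>t. norm (f m t) \<partial>lborel) \<le> norm (S m) * (C * (\<integral>t. norm (k t) \<partial>lborel))" for m
    proof -
      have "(\<integral>t. norm (f m t) \<partial>lborel) \<le> (\<integral>t. norm (S m) * (C * norm (k t)) \<partial>lborel)"
        by (intro integral_mono integrable_norm f_int integrable_mult_right k f_le)
      thus ?thesis by (simp add: integral_nonneg_AE)
    qed
  qed
  have eq: "(\<Sum>m. f m t) = indicator {0<..<1} t *\<^sub>R ((\<Sum>m. t ^ m *\<^sub>R S m) ** K t)" for t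
  proof (cases "t \<in> {0<..<1}")
    case True
    have "summable (\<lambda>m. t ^ m *\<^sub>R S m)"
    proof (rule summable_norm_cancel, rule summable_comparison_test'[OF S, of 0])
      have "\<bar>t\<bar> ^ m \<le> 1" for m using True by (simp add: power_le_one)
      thus "norm (norm (t ^ m *\<^sub>R S m)) \<le> norm (S m)" for m
        by (simp add: power_abs mult_left_le_one_le)
    qed
    from sums_unique[OF bounded_linear.sums[OF matmul.bounded_linear_left summable_sums[OF this], of "K t"]]
    show ?thesis using True by (simp add: f_def k_def matmul.scaleR_left matmul.scaleR_right)
  qed (simp add: f_def k_def matmul.zero_right)
  have "t ^ m *\<^sub>R k t = indicator {0<..<1} t *\<^sub>R (t ^ m *\<^sub>R K t)" for t m
    by (simp add: k_def mult.commute)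
  hence f_val': "integral\<^sup>L lborel (f m) = S m ** (LINT t:{0<..<1}|lborel. t ^ m *\<^sub>R K t)" for m
    by (simp add: f_val set_lebesgue_integral_def)
  show "set_integrable lborel {0<..<1} (\<lambda>t. (\<Sum>m. t ^ m *\<^sub>R S m) ** K t)"
    using integrable_suminf[OF f_int 1 2] by (simp add: set_integrable_def eq)
  show "(\<lambda>m. S m ** (LINT t:{0<..<1}|lborel. t ^ m *\<^sub>R K t)) sums
      (LINT t:{0<..<1}|lborel. (\<Sum>m. t ^ m *\<^sub>R S m) ** K t)"
    using sums_integral[OF f_int 1 2] by (simp add: set_lebesgue_integral_def eq f_val')
qed

section \<open>Terms of the incomplete exponential series\<close>

lemma inc_exp_term_scale:
  fixes A B :: "complex^'r^'r"
  shows
  "inc_exp_term p q x A B E F (of_real t * v) m = t ^ m *\<^sub>R inc_exp_term p q x A B E F v m"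
proof -
  have "mat ((of_real t * v) ^ m / fact m) = t ^ m *\<^sub>R (mat (v ^ m / fact m) :: complex^'r^'r)"
    by (simp only: scaleR_mat) (simp add: power_mult_distrib)
  thus ?thesis by (simp only: inc_exp_term_def matmul.scaleR_left)
qed

lemma mat_prod_commute:
  assumes "\<And>j. 1 \<le> j \<Longrightarrow> j \<le> n \<Longrightarrow> X ** Y j = Y j ** X"
  shows "X ** mat_prod Y n = mat_prod Y n ** X"
  using assms
proof (induction n)
  case (Suc n)
  hence "X ** mat_prod Y n = mat_prod Y n ** X" "X ** Y (Suc n) = Y (Suc n) ** X" by auto
  thus ?case by (simp add: matrix_mul_assoc) (metis matrix_mul_assoc)
qed simp

text \<open>The factor (E_p)_m stands directly before the inverses belonging to F_1, ..., F_(q-1)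
  and is moved past exactly these, ending up next to the inverse of (F_q)_m; all other factors keep
  their order.\<close>

lemma inc_exp_term_Suc:
  assumes comm: "\<And>j. 1 \<le> j \<Longrightarrow> j \<le> q \<Longrightarrow> E (Suc p) ** F j = F j ** E (Suc p)"
    and inv: "\<And>j k. 1 \<le> j \<Longrightarrow> j \<le> q \<Longrightarrow> invertible (F j + mat (of_nat k))"
  shows "inc_exp_term (Suc p) (Suc q) x A B E F v m = inc_exp_term p q x A B E F v m **
    (mat_pochhammer (E (Suc p)) m ** matrix_inv (mat_pochhammer (F (Suc q)) m))"
proof -
  have "mat_pochhammer (E (Suc p)) m ** mat_prod (\<lambda>j. matrix_inv (mat_pochhammer (F j) m)) q =
      mat_prod (\<lambda>j. matrix_inv (mat_pochhammer (F j) m)) q ** mat_pochhammer (E (Suc p)) m"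
  proof (rule mat_prod_commute)
    fix j assume j: "1 \<le> j" "j \<le> q"
    have "F j ** mat_pochhammer (E (Suc p)) m = mat_pochhammer (E (Suc p)) m ** F j"
      using comm[OF j] by (intro mat_pochhammer_commute) simp
    hence "mat_pochhammer (E (Suc p)) m ** mat_pochhammer (F j) m =
        mat_pochhammer (F j) m ** mat_pochhammer (E (Suc p)) m"
      by (intro mat_pochhammer_commute) simp
    thus "mat_pochhammer (E (Suc p)) m ** matrix_inv (mat_pochhammer (F j) m) =
        matrix_inv (mat_pochhammer (F j) m) ** mat_pochhammer (E (Suc p)) m"
      using inv[OF j] by (intro matrix_inv_commute invertible_mat_pochhammer)
  qed
  thus ?thesis
    by (simp add: inc_exp_term_def flip: matrix_mul_assoc) (simp add: matrix_mul_assoc)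
qed

text \<open>The first two conjuncts certify that the third means what it should: the Bochner
  integral of a non-integrable function is 0 by convention, and \<open>matrix_inv\<close> of a
  singular matrix is an arbitrary choice.\<close>

theorem theorem5p2:
  fixes p q :: nat
    and A B :: "complex^'r^'r"
    and E F :: "nat \<Rightarrow> complex^'r^'r"
    and x :: real
    and v :: complex
  assumes "p \<ge> 1" and "q \<ge> 1"
    and "\<And>j. 1 \<le> j \<Longrightarrow> j \<le> q \<Longrightarrow> E p ** F j = F j ** E p"
    and "\<And>j k. 1 \<le> j \<Longrightarrow> j \<le> q \<Longrightarrow> invertible (F j + mat (of_nat k))"
    and "positive_stable (E p)"
    and "positive_stable (F q)"
    and "positive_stable (F q - E p)"
    and "x > 0"
    and "summable (\<lambda>m. norm (inc_exp_term p q x A B E F v m))"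
    and "summable (\<lambda>m. norm (inc_exp_term (p - 1) (q - 1) x A B E F v m))"
  shows
    "set_integrable lborel {0<..<1} (\<lambda>t.
           inc_exp_mat (p - 1) (q - 1) x A B E F (of_real t * v) **
           mat_powr t (E p - mat 1) ** mat_powr (1 - t) (F q - E p - mat 1))
     \<and> invertible (mat_Beta (E p) (F q - E p))
     \<and> inc_exp_mat p q x A B E F v =
         (LINT t:{0<..<1}|lborel.
           inc_exp_mat (p - 1) (q - 1) x A B E F (of_real t * v) **
           mat_powr t (E p - mat 1) ** mat_powr (1 - t) (F q - E p - mat 1)) **
         matrix_inv (mat_Beta (E p) (F q - E p))"
proof -
  define G where "G = F q - E p"
  have FG: "F q = E p + G" by (simp add: G_def)
  have stable: "positive_stable (E p)" "positive_stable G" "positive_stable (E p + G)"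
    using assms by (simp_all add: G_def)
  have comm: "E p ** G = G ** E p"
    using assms(3)[of q] assms(2) by (simp add: G_def matmul.diff_left matmul.diff_right)
  define S where "S = inc_exp_term (p - 1) (q - 1) x A B E F v"
  define K where "K t = mat_powr t (E p - mat 1) ** mat_powr (1 - t) (G - mat 1)" for t
  define I where "I = (LINT t:{0<..<1}|lborel. (\<Sum>m. t ^ m *\<^sub>R S m) ** K t)"
  have K: "set_integrable lborel {0<..<1} K"
    unfolding K_def by (rule mat_Beta_integrable[OF stable(1,2)])
  have S: "summable (\<lambda>m. norm (S m))" using assms(10) by (simp add: S_def)
  have integrand: "inc_exp_mat (p - 1) (q - 1) x A B E F (of_real t * v) **
      mat_powr t (E p - mat 1) ** mat_powr (1 - t) (F q - E p - mat 1) = (\<Sum>m. t ^ m *\<^sub>R S m) ** K t" for t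
    by (simp add: inc_exp_mat_def inc_exp_term_scale S_def K_def G_def matrix_mul_assoc)
  have inv: "invertible (mat_Beta (E p) G)" by (rule invertible_mat_Beta[OF stable])
  \<comment> \<open>Multiplying by the beta factor on the right turns each term of the full series
    into a moment of \<open>K\<close>, so both sides can be summed before the beta factor is
    inverted.\<close>
  have "S m ** (LINT t:{0<..<1}|lborel. t ^ m *\<^sub>R K t) =
      inc_exp_term p q x A B E F v m ** mat_Beta (E p) G" for m
  proof -
    have "inc_exp_term p q x A B E F v m =
        S m ** (mat_pochhammer (E p) m ** matrix_inv (mat_pochhammer (F q) m))"
      using inc_exp_term_Suc[of "q - 1" E "p - 1" F x A B v m] assms(1-4) by (simp add: S_def)
    thus ?thesis
      using mat_Beta_moment[OF stable comm, of m] by (simp add: K_def FG matrix_mul_assoc)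
  qed
  hence "(\<lambda>m. inc_exp_term p q x A B E F v m ** mat_Beta (E p) G) sums I"
    using set_integral_matrix_power_series(2)[OF S K] by (simp add: I_def)
  moreover have "inc_exp_term p q x A B E F v sums inc_exp_mat p q x A B E F v"
    unfolding inc_exp_mat_def by (rule summable_sums[OF summable_norm_cancel[OF assms(9)]])
  hence "(\<lambda>m. inc_exp_term p q x A B E F v m ** mat_Beta (E p) G) sums
      (inc_exp_mat p q x A B E F v ** mat_Beta (E p) G)"
    by (rule bounded_linear.sums[OF matmul.bounded_linear_left])
  ultimately have "I = inc_exp_mat p q x A B E F v ** mat_Beta (E p) G" by (rule sums_unique2)
  hence "inc_exp_mat p q x A B E F v = I ** matrix_inv (mat_Beta (E p) G)"
    using matrix_inv_mult(1)[OF inv] by (metis matrix_mul_assoc matrix_mul_rid)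
  thus ?thesis
    using set_integral_matrix_power_series(1)[OF S K] inv
    unfolding integrand by (simp add: I_def G_def)
qed

end
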